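(* Let $\mathscr G$ and $\mathscr H$ be small groupoids. Any isomorphism of categories $\Psi:\mathrm{Sd}\,\mathscr G\to\mathrm{Sd}\,\mathscr H$ induces an isomorphism $P:\mathscr G\to\mathscr H$; that is, whenever such a $\Psi$ exists, there exists an isomorphism of categories (a covariant functor with a strict inverse) $P:\mathscr G\to\mathscr H$.
   Context: For $n\ge 0$, $[n]$ denotes the poset category $0<1<\cdots<n$, and $\mathbf\Delta$ is the full subcategory of $\mathbf{Cat}$ on the $[n]$; its morphisms are the order-preserving maps, its monomorphisms the injective ones and its epimorphisms the surjective ones. For a small category $\mathscr C$, an $n$-simplex of the nerve $N\mathscr C$ is a functor $x:[n]\to\mathscr C$, and $\mu^*x=x\circ\mu$ for $\mu:[m]\to[n]$ in $\mathbf\Delta$. A simplex $y$ is degenerate if $y=\sigma^*x$ for some simplex $x$ and some non-identity epimorphism $\sigma$ of $\mathbf\Delta$ (equivalently, some arrow $y([i-1<i])$ is an identity). The subdivision $\mathrm{Sd}\,\mathscr C$ is the category whose objects are the non-degenerate simplices (of all dimensions $\ge 0$) of $N\mathscr C$. A morphism from $x:[m]\to\mathscr C$ to $y:[n]\to\mathscr C$ is a pair $(\sigma,\nu)$ of morphisms of $\mathbf\Delta$ with a common domain $[k]$, where $\sigma:[k]\to[m]$ is an epimorphism, $\nu:[k]\to[n]$ is a monomorphism, and $\sigma^*x=\nu^*y$. Such a pair is determined by the binary relation (multivalued function) $\nu\circ\sigma^{-1}$ from $\{0,\ldots,m\}$ to $\{0,\ldots,n\}$, and composition in $\mathrm{Sd}\,\mathscr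 C$ is composition of these relations; the identity of $x:[m]\to\mathscr C$ is $(\mathrm{id}_{[m]},\mathrm{id}_{[m]})$. *)

theory Defs
  imports Main "HOL-Library.FuncSet"
begin

record ('o, 'a) cat =
  Obj :: "'o set"
  Arr :: "'a set"
  Dom :: "'a \<Rightarrow> 'o"
  Cod :: "'a \<Rightarrow> 'o"
  Ident :: "'o \<Rightarrow> 'a"
  Comp :: "'a \<Rightarrow> 'a \<Rightarrow> 'a"

(* Comp C g f is "g after f"; it is only meaningful when Dom C g = Cod C f. *)
locale category =
  fixes C :: "('o, 'a) cat"
  assumes Dom_in: "f \<in> Arr C \<Longrightarrow> Dom C f \<in> Obj C"
    and Cod_in: "f \<in> Arr C \<Longrightarrow> Cod C f \<in> Obj C"
    and Ident_in: "X \<in> Obj C \<Longrightarrow> Ident C X \<in> Arr C"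
    and Dom_Ident: "X \<in> Obj C \<Longrightarrow> Dom C (Ident C X) = X"
    and Cod_Ident: "X \<in> Obj C \<Longrightarrow> Cod C (Ident C X) = X"
    and Comp_in: "\<lbrakk>f \<in> Arr C; g \<in> Arr C; Dom C g = Cod C f\<rbrakk> \<Longrightarrow> Comp C g f \<in> Arr C"
    and Dom_Comp: "\<lbrakk>f \<in> Arr C; g \<in> Arr C; Dom C g = Cod C f\<rbrakk> \<Longrightarrow> Dom C (Comp C g f) = Dom C f"
    and Cod_Comp: "\<lbrakk>f \<in> Arr C; g \<in> Arr C; Dom C g = Cod C f\<rbrakk> \<Longrightarrow> Cod C (Comp C g f) = Cod C g"
    and Comp_Ident_right: "f \<in> Arr C \<Longrightarrow> Comp C f (Ident C (Dom C f)) = f"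
    and Comp_Ident_left: "f \<in> Arr C \<Longrightarrow> Comp C (Ident C (Cod C f)) f = f"
    and Comp_assoc: "\<lbrakk>f \<in> Arr C; g \<in> Arr C; h \<in> Arr C; Dom C g = Cod C f; Dom C h = Cod C g\<rbrakk>
      \<Longrightarrow> Comp C h (Comp C g f) = Comp C (Comp C h g) f"

locale groupoid = category +
  assumes inverse_ex: "f \<in> Arr C \<Longrightarrow> \<exists>g \<in> Arr C. Dom C g = Cod C f \<and> Cod C g = Dom C f
    \<and> Comp C g f = Ident C (Dom C f) \<and> Comp C f g = Ident C (Cod C f)"

record ('o, 'a, 'p, 'b) functor_data =
  omap :: "'o \<Rightarrow> 'p"
  amap :: "'a \<Rightarrow> 'b"

(* Both maps are extensional, so that functors between fixed categories are equal as
   functors exactly when they are equal in HOL. *)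
definition is_functor :: "('o, 'a) cat \<Rightarrow> ('p, 'b) cat \<Rightarrow> ('o, 'a, 'p, 'b) functor_data \<Rightarrow> bool" where
  "is_functor A B F \<longleftrightarrow>
     omap F \<in> Obj A \<rightarrow>\<^sub>E Obj B \<and>
     amap F \<in> Arr A \<rightarrow>\<^sub>E Arr B \<and>
     (\<forall>f \<in> Arr A. Dom B (amap F f) = omap F (Dom A f) \<and> Cod B (amap F f) = omap F (Cod A f)) \<and>
     (\<forall>X \<in> Obj A. amap F (Ident A X) = Ident B (omap F X)) \<and>
     (\<forall>f \<in> Arr A. \<forall>g \<in> Arr A. Dom A g = Cod A f \<longrightarrow>
        amap F (Comp A g f) = Comp B (amap F g) (amap F f))"

definition id_functor :: "('o, 'a) cat \<Rightarrow> ('o, 'a, 'o, 'a) functor_data" where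
  "id_functor A = \<lparr>omap = (\<lambda>X \<in> Obj A. X), amap = (\<lambda>f \<in> Arr A. f)\<rparr>"

(* G after F, where A is the domain of F *)
definition comp_functor :: "('o, 'a) cat \<Rightarrow> ('p, 'b, 'q, 'c) functor_data
    \<Rightarrow> ('o, 'a, 'p, 'b) functor_data \<Rightarrow> ('o, 'a, 'q, 'c) functor_data" where
  "comp_functor A G F =
     \<lparr>omap = compose (Obj A) (omap G) (omap F), amap = compose (Arr A) (amap G) (amap F)\<rparr>"

definition is_cat_iso :: "('o, 'a) cat \<Rightarrow> ('p, 'b) cat \<Rightarrow> ('o, 'a, 'p, 'b) functor_data \<Rightarrow> bool" where
  "is_cat_iso A B F \<longleftrightarrow> is_functor A B F \<and>
     (\<exists>G. is_functor B A G \<and> comp_functor A G F = id_functor A \<and> comp_functor B F G = id_functor B)"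


(* The poset category 0 < 1 < ... < n; the arrow from i to j is the pair (i, j). *)
definition ord_cat :: "nat \<Rightarrow> (nat, nat \<times> nat) cat" where
  "ord_cat n = \<lparr>Obj = {..n}, Arr = {(i, j). i \<le> j \<and> j \<le> n}, Dom = fst, Cod = snd,
     Ident = (\<lambda>i. (i, i)), Comp = (\<lambda>g f. (fst f, snd g))\<rparr>"

(* A map [m] -> [n] of the simplex category is a functor ord_cat m -> ord_cat n, i.e. an
   order-preserving map, given by its object part. *)
type_synonym delta_map = "(nat, nat \<times> nat, nat, nat \<times> nat) functor_data"

definition delta_mono :: "nat \<Rightarrow> nat \<Rightarrow> delta_map \<Rightarrow> bool" where
  "delta_mono m n \<mu> \<longleftrightarrow> is_functor (ord_cat m) (ord_cat n) \<mu> \<and> inj_on (omap \<mu>) {..m}"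

definition delta_epi :: "nat \<Rightarrow> nat \<Rightarrow> delta_map \<Rightarrow> bool" where
  "delta_epi m n \<mu> \<longleftrightarrow> is_functor (ord_cat m) (ord_cat n) \<mu> \<and> omap \<mu> ` {..m} = {..n}"

(* The dimension is stored explicitly: it cannot be recovered from extensional maps alone. *)
type_synonym ('o, 'a) simplex = "nat \<times> (nat, nat \<times> nat, 'o, 'a) functor_data"

definition nerve :: "('o, 'a) cat \<Rightarrow> ('o, 'a) simplex set" where
  "nerve C = {(n, x). is_functor (ord_cat n) C x}"

(* The restriction of x along \<mu> : [k] -> [n], where n is the dimension of x *)
definition pull :: "nat \<Rightarrow> delta_map \<Rightarrow> ('o, 'a) simplex \<Rightarrow> ('o, 'a) simplex" where
  "pull k \<mu> x = (k, comp_functor (ord_cat k) (snd x) \<mu>)"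

definition degenerate :: "('o, 'a) cat \<Rightarrow> ('o, 'a) simplex \<Rightarrow> bool" where
  "degenerate C y \<longleftrightarrow> (\<exists>x \<in> nerve C. \<exists>\<sigma>. delta_epi (fst y) (fst x) \<sigma> \<and>
     \<not> (fst x = fst y \<and> \<sigma> = id_functor (ord_cat (fst y))) \<and> y = pull (fst y) \<sigma> x)"


(* A morphism (\<sigma>, \<nu>), with its source, its target and the k of the common domain [k] *)
record ('o, 'a) sd_arrow =
  sd_dom :: "('o, 'a) simplex"
  sd_cod :: "('o, 'a) simplex"
  sd_apex :: nat
  sd_epi :: delta_map
  sd_mono :: delta_map

definition sd_objs :: "('o, 'a) cat \<Rightarrow> ('o, 'a) simplex set" where
  "sd_objs C = {x \<in> nerve C. \<not> degenerate C x}"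

definition sd_arrs :: "('o, 'a) cat \<Rightarrow> ('o, 'a) sd_arrow set" where
  "sd_arrs C = {f. sd_dom f \<in> sd_objs C \<and> sd_cod f \<in> sd_objs C \<and>
     delta_epi (sd_apex f) (fst (sd_dom f)) (sd_epi f) \<and>
     delta_mono (sd_apex f) (fst (sd_cod f)) (sd_mono f) \<and>
     pull (sd_apex f) (sd_epi f) (sd_dom f) = pull (sd_apex f) (sd_mono f) (sd_cod f)}"

(* The relation \<nu> o \<sigma>^{-1} *)
definition sd_rel :: "('o, 'a) sd_arrow \<Rightarrow> (nat \<times> nat) set" where
  "sd_rel f = {(omap (sd_epi f) i, omap (sd_mono f) i) | i. i \<le> sd_apex f}"

(* The description is well defined on composable arrows: see sd_comp_ex1 below. *)
definition sd_comp :: "('o, 'a) cat \<Rightarrow> ('o, 'a) sd_arrow \<Rightarrow> ('o, 'a) sd_arrow \<Rightarrow> ('o, 'a) sd_arrow" where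
  "sd_comp C g f = (THE h. h \<in> sd_arrs C \<and> sd_dom h = sd_dom f \<and> sd_cod h = sd_cod g \<and>
     sd_rel h = sd_rel f O sd_rel g)"

definition Sd :: "('o, 'a) cat \<Rightarrow> (('o, 'a) simplex, ('o, 'a) sd_arrow) cat" where
  "Sd C = \<lparr>Obj = sd_objs C, Arr = sd_arrs C, Dom = sd_dom, Cod = sd_cod,
     Ident = (\<lambda>x. \<lparr>sd_dom = x, sd_cod = x, sd_apex = fst x,
       sd_epi = id_functor (ord_cat (fst x)), sd_mono = id_functor (ord_cat (fst x))\<rparr>),
     Comp = sd_comp C\<rparr>"


definition delta_of :: "nat \<Rightarrow> (nat \<Rightarrow> nat) \<Rightarrow> delta_map" where
  "delta_of m \<mu> = \<lparr>omap = restrict \<mu> {..m},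
     amap = restrict (\<lambda>(i, j). (\<mu> i, \<mu> j)) {(i, j). i \<le> j \<and> j \<le> m}\<rparr>"

lemma ord_cat_simps [simp]:
  "Obj (ord_cat n) = {..n}" "Arr (ord_cat n) = {(i, j). i \<le> j \<and> j \<le> n}"
  "Dom (ord_cat n) = fst" "Cod (ord_cat n) = snd"
  "Ident (ord_cat n) i = (i, i)" "Comp (ord_cat n) g f = (fst f, snd g)"
  by (simp_all add: ord_cat_def)

lemma is_functor_delta_of:
  assumes "\<And>i. i \<le> m \<Longrightarrow> \<mu> i \<le> n" "\<And>i j. i \<le> j \<Longrightarrow> j \<le> m \<Longrightarrow> \<mu> i \<le> \<mu> j"
  shows "is_functor (ord_cat m) (ord_cat n) (delta_of m \<mu>)"
  using assms unfolding is_functor_def delta_of_def by (auto simp: PiE_def Pi_def)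

lemma delta_functorD:
  assumes "is_functor (ord_cat m) (ord_cat n) F"
  shows "F = delta_of m (omap F)"
    and "\<And>i. i \<le> m \<Longrightarrow> omap F i \<le> n"
    and "\<And>i j. i \<le> j \<Longrightarrow> j \<le> m \<Longrightarrow> omap F i \<le> omap F j"
    and "\<And>i j. i \<le> j \<Longrightarrow> j \<le> m \<Longrightarrow> amap F (i, j) = (omap F i, omap F j)"
proof -
  note D = assms[unfolded is_functor_def ord_cat_simps]
  have o: "omap F \<in> {..m} \<rightarrow>\<^sub>E {..n}"
    and a: "amap F \<in> {(i, j). i \<le> j \<and> j \<le> m} \<rightarrow>\<^sub>E {(i, j). i \<le> j \<and> j \<le> n}"
    using D by simp_all
  note D3 = D[THEN conjunct2, THEN conjunct2, THEN conjunct1]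
  have dc: "fst (amap F (i, j)) = omap F i \<and> snd (amap F (i, j)) = omap F j" if "i \<le> j" "j \<le> m" for i j
    using bspec[OF D3, of "(i, j)"] that by simp
  show 2: "amap F (i, j) = (omap F i, omap F j)" if "i \<le> j" "j \<le> m" for i j
    using dc[OF that] by (metis prod.collapse)
  show "omap F i \<le> n" if "i \<le> m" for i using o that by auto
  show "omap F i \<le> omap F j" if "i \<le> j" "j \<le> m" for i j
    using PiE_mem[OF a, of "(i, j)"] that 2 by auto
  have "restrict (omap F) {..m} = omap F" using o by (auto intro: PiE_restrict)
  moreover have "restrict (\<lambda>(i, j). (omap F i, omap F j)) {(i, j). i \<le> j \<and> j \<le> m} = amap F"
    using a 2 by (auto simp: fun_eq_iff PiE_def extensional_def)
  ultimately show "F = delta_of m (omap F)" unfolding delta_of_def by simp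
qed

lemma strict_enum_unique:
  fixes f g :: "nat \<Rightarrow> nat"
  assumes f: "strict_mono_on {..k} f" and g: "strict_mono_on {..k} g"
    and im: "f ` {..k} = g ` {..k}" and "i \<le> k"
  shows "f i = g i"
  using \<open>i \<le> k\<close>
proof (induction i rule: less_induct)
  case (less i)
  have le: "a i \<le> b i" if a: "strict_mono_on {..k} a" and b: "strict_mono_on {..k} b"
    and ab: "a ` {..k} = b ` {..k}" and IH: "\<And>j. j < i \<Longrightarrow> a j = b j" for a b :: "nat \<Rightarrow> nat"
  proof -
    have "b i \<in> a ` {..k}" using ab less.prems by auto
    then obtain j where j: "j \<le> k" "b i = a j" by auto
    have "\<not> j < i"
    proof
      assume "j < i"
      then have "b i = b j" using j IH by simp
      moreover have "b j < b i" using strict_mono_onD[OF b] less.prems \<open>j < i\<close> by simp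
      ultimately show False by simp
    qed
    then show ?thesis
      using a j by (metis atMost_iff less.prems linorder_not_less order.order_iff_strict strict_mono_onD)
  qed
  have IH: "f j = g j" if "j < i" for j using less that by simp
  show ?case using le[OF f g im IH] le[OF g f im[symmetric] IH[symmetric]] by (rule le_antisym)
qed

lemma delta_mono_strict:
  assumes "delta_mono k n \<nu>" shows "strict_mono_on {..k} (omap \<nu>)"
proof (rule strict_mono_onI)
  fix i j assume "i \<in> {..k}" "j \<in> {..k}" "i < j"
  then show "omap \<nu> i < omap \<nu> j"
    using assms delta_functorD(3)[of k n \<nu> i j] unfolding delta_mono_def inj_on_def
    by (metis atMost_iff less_imp_le nat_less_le)
qed

lemma sd_arr_eqI:
  assumes f: "f \<in> sd_arrs C" and g: "g \<in> sd_arrs C"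
    and d: "sd_dom f = sd_dom g" and c: "sd_cod f = sd_cod g" and r: "sd_rel f = sd_rel g"
  shows "f = (g :: ('o, 'a) sd_arrow)"
proof -
  let ?k = "sd_apex f" and ?l = "sd_apex g"
  let ?\<sigma> = "omap (sd_epi f)" and ?\<nu> = "omap (sd_mono f)"
  let ?\<tau> = "omap (sd_epi g)" and ?\<rho> = "omap (sd_mono g)"
  have mf: "delta_mono ?k (fst (sd_cod f)) (sd_mono f)" and mg: "delta_mono ?l (fst (sd_cod g)) (sd_mono g)"
    and ef: "delta_epi ?k (fst (sd_dom f)) (sd_epi f)" and eg: "delta_epi ?l (fst (sd_dom g)) (sd_epi g)"
    using f g by (simp_all add: sd_arrs_def)
  have im: "?\<nu> ` {..?k} = Range (sd_rel f)" "?\<rho> ` {..?l} = Range (sd_rel g)"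
    unfolding sd_rel_def by auto
  then have im': "?\<nu> ` {..?k} = ?\<rho> ` {..?l}" using r by simp
  then have "card (?\<nu> ` {..?k}) = card (?\<rho> ` {..?l})" by simp
  then have kl: "?k = ?l" using mf mg by (simp add: delta_mono_def card_image)
  have \<nu>: "?\<nu> i = ?\<rho> i" if "i \<le> ?k" for i
    using strict_enum_unique[OF delta_mono_strict[OF mf], of ?\<rho> i] delta_mono_strict[OF mg] im' kl that
    by simp
  have \<sigma>: "?\<sigma> i = ?\<tau> i" if i: "i \<le> ?k" for i
  proof -
    have "(?\<sigma> i, ?\<nu> i) \<in> sd_rel g" using i r unfolding sd_rel_def by blast
    then obtain j where j: "j \<le> ?k" "?\<sigma> i = ?\<tau> j" "?\<nu> i = ?\<rho> j" unfolding sd_rel_def kl by auto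
    then have "?\<rho> i = ?\<rho> j" using \<nu> i by simp
    then have "i = j" using mg i j kl unfolding delta_mono_def inj_on_def by auto
    then show ?thesis using j by simp
  qed
  have eq: "delta_of ?k a = delta_of ?k b" if "\<And>i. i \<le> ?k \<Longrightarrow> a i = b i" for a b
    using that unfolding delta_of_def by (auto intro!: restrict_ext)
  note M = delta_functorD(1)[OF mf[unfolded delta_mono_def, THEN conjunct1]]
    delta_functorD(1)[OF mg[unfolded delta_mono_def, THEN conjunct1], folded kl]
  have "sd_mono f = sd_mono g" by (rule trans[OF M(1) trans[OF eq[OF \<nu>] M(2)[symmetric]]])
  note E = delta_functorD(1)[OF ef[unfolded delta_epi_def, THEN conjunct1]]
    delta_functorD(1)[OF eg[unfolded delta_epi_def, THEN conjunct1], folded kl]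
  have "sd_epi f = sd_epi g" by (rule trans[OF E(1) trans[OF eq[OF \<sigma>] E(2)[symmetric]]])
  then show ?thesis using d c kl \<open>sd_mono f = sd_mono g\<close> by simp
qed

lemma ex_strict_enum:
  fixes J :: "nat set"
  assumes "finite J" "J \<noteq> {}"
  obtains q :: nat and e :: "nat \<Rightarrow> nat" where "strict_mono_on {..q} e" "e ` {..q} = J"
proof -
  let ?xs = "sorted_list_of_set J"
  have "strict_mono_on {..card J - 1} (\<lambda>i. ?xs ! i)"
  proof (rule strict_mono_onI)
    fix r s assume "r \<in> {..card J - 1}" "s \<in> {..card J - 1}" "r < s"
    moreover have "sorted_wrt (<) ?xs" by simp
    ultimately show "?xs ! r < ?xs ! s"
      using assms by (auto simp: sorted_wrt_iff_nth_less card_gt_0_iff)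
  qed
  moreover have "(\<lambda>i. ?xs ! i) ` {..card J - 1} = J"
  proof -
    have "card J > 0" using assms by (simp add: card_gt_0_iff)
    then have "{..card J - 1} = {..<length ?xs}" by auto
    then have "(\<lambda>i. ?xs ! i) ` {..card J - 1} = set ?xs" by (auto simp: set_conv_nth)
    then show ?thesis using assms by simp
  qed
  ultimately show thesis by (rule that)
qed

lemma pull_eqD:
  assumes "pull k \<sigma> x = pull k \<nu> y"
    and "is_functor (ord_cat k) (ord_cat m) \<sigma>" "is_functor (ord_cat k) (ord_cat n) \<nu>"
  shows "\<And>i. i \<le> k \<Longrightarrow> omap (snd x) (omap \<sigma> i) = omap (snd y) (omap \<nu> i)"
    and "\<And>i j. i \<le> j \<Longrightarrow> j \<le> k \<Longrightarrow>
      amap (snd x) (omap \<sigma> i, omap \<sigma> j) = amap (snd y) (omap \<nu> i, omap \<nu> j)"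
proof -
  have e: "compose {..k} (omap (snd x)) (omap \<sigma>) = compose {..k} (omap (snd y)) (omap \<nu>)"
    "compose {(i, j). i \<le> j \<and> j \<le> k} (amap (snd x)) (amap \<sigma>)
      = compose {(i, j). i \<le> j \<and> j \<le> k} (amap (snd y)) (amap \<nu>)"
    using assms(1) by (auto simp: pull_def comp_functor_def)
  show "omap (snd x) (omap \<sigma> i) = omap (snd y) (omap \<nu> i)" if "i \<le> k" for i
    using fun_cong[OF e(1), of i] that by (simp add: compose_def)
  show "amap (snd x) (omap \<sigma> i, omap \<sigma> j) = amap (snd y) (omap \<nu> i, omap \<nu> j)"
    if "i \<le> j" "j \<le> k" for i j
    using fun_cong[OF e(2), of "(i, j)"] that
      delta_functorD(4)[OF assms(2) that] delta_functorD(4)[OF assms(3) that] by (simp add: compose_def)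
qed

lemma sd_comp_ex1:
  fixes C :: "('o, 'a) cat"
  assumes f: "f \<in> sd_arrs C" and g: "g \<in> sd_arrs C" and fg: "sd_dom g = sd_cod f"
  shows "\<exists>!h. h \<in> sd_arrs C \<and> sd_dom h = sd_dom f \<and> sd_cod h = sd_cod g \<and> sd_rel h = sd_rel f O sd_rel g"
proof (rule ex_ex1I)
  fix h h' :: "('o, 'a) sd_arrow"
  assume "h \<in> sd_arrs C \<and> sd_dom h = sd_dom f \<and> sd_cod h = sd_cod g \<and> sd_rel h = sd_rel f O sd_rel g"
    and "h' \<in> sd_arrs C \<and> sd_dom h' = sd_dom f \<and> sd_cod h' = sd_cod g \<and> sd_rel h' = sd_rel f O sd_rel g"
  then show "h = h'" by (intro sd_arr_eqI) auto
next
  define k l where "k = sd_apex f" and "l = sd_apex g"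
  define x y z where "x = sd_dom f" and "y = sd_cod f" and "z = sd_cod g"
  define \<sigma> \<nu> \<tau> \<rho> where "\<sigma> = omap (sd_epi f)" and "\<nu> = omap (sd_mono f)"
    and "\<tau> = omap (sd_epi g)" and "\<rho> = omap (sd_mono g)"
  note defs = k_def l_def x_def y_def z_def \<sigma>_def \<nu>_def \<tau>_def \<rho>_def
  have mf: "delta_mono k (fst y) (sd_mono f)" and mg: "delta_mono l (fst z) (sd_mono g)"
    and ef: "delta_epi k (fst x) (sd_epi f)" and eg: "delta_epi l (fst y) (sd_epi g)"
    and pf: "pull k (sd_epi f) x = pull k (sd_mono f) y"
    and pg: "pull l (sd_epi g) y = pull l (sd_mono g) z"
    using f g fg by (simp_all add: sd_arrs_def defs)
  note F = ef[unfolded delta_epi_def, THEN conjunct1] mf[unfolded delta_mono_def, THEN conjunct1]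
  note G = eg[unfolded delta_epi_def, THEN conjunct1] mg[unfolded delta_mono_def, THEN conjunct1]
  note Q = pull_eqD[OF pf F, folded \<sigma>_def \<nu>_def]
  note R = pull_eqD[OF pg G, folded \<tau>_def \<rho>_def]
  have \<nu>s: "strict_mono_on {..k} \<nu>" and \<rho>s: "strict_mono_on {..l} \<rho>"
    using mf mg delta_mono_strict by (auto simp: defs)
  have \<sigma>i: "\<sigma> ` {..k} = {..fst x}" and \<tau>i: "\<tau> ` {..l} = {..fst y}"
    using ef eg by (auto simp: delta_epi_def defs)
  define J where "J = {j. j \<le> l \<and> \<tau> j \<in> \<nu> ` {..k}}"
  have \<nu>le: "\<nu> i \<le> fst y" if "i \<le> k" for i using delta_functorD(2)[OF F(2)] that by (simp add: defs)
  have lift: "\<exists>j \<in> J. \<tau> j = \<nu> i" if "i \<le> k" for i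
  proof -
    have "\<nu> i \<in> \<tau> ` {..l}" using \<tau>i \<nu>le[OF that] by auto
    then obtain j where j: "j \<le> l" "\<tau> j = \<nu> i" by auto
    then have "j \<in> J" using that unfolding J_def by simp
    then show ?thesis using j by blast
  qed
  have "finite J" "J \<noteq> {}" using lift[of 0] unfolding J_def by auto
  then obtain q :: nat and e :: "nat \<Rightarrow> nat" where e: "strict_mono_on {..q} e" and eJ: "e ` {..q} = J" by (rule ex_strict_enum)
  define u where "u i = inv_into {..k} \<nu> (\<tau> (e i))" for i
  have u: "u i \<le> k" "\<nu> (u i) = \<tau> (e i)" "e i \<le> l" if "i \<le> q" for i
  proof -
    have "e i \<in> J" using eJ that by auto
    then show "u i \<le> k" "\<nu> (u i) = \<tau> (e i)" "e i \<le> l"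
      using inv_into_into[of "\<tau> (e i)" \<nu> "{..k}"] f_inv_into_f[of "\<tau> (e i)" \<nu> "{..k}"]
      unfolding J_def u_def by auto
  qed
  have emono: "e i \<le> e j" if "i \<le> j" "j \<le> q" for i j
    using e that by (metis atMost_iff le_trans order.order_iff_strict strict_mono_onD)
  have umono: "u i \<le> u j" if "i \<le> j" "j \<le> q" for i j
  proof (rule ccontr)
    assume "\<not> u i \<le> u j"
    then have "\<nu> (u j) < \<nu> (u i)"
      using strict_mono_onD[OF \<nu>s, of "u j" "u i"] u(1)[of i] u(1)[of j] that by simp
    moreover have "\<tau> (e i) \<le> \<tau> (e j)"
      using delta_functorD(3)[OF G(1), of "e i" "e j"] emono[OF that] u(3)[of j] that by (simp add: defs)
    ultimately show False using u(2)[of i] u(2)[of j] that by simp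
  qed
  have \<sigma>mono: "\<sigma> i \<le> \<sigma> j" if "i \<le> j" "j \<le> k" for i j
    using delta_functorD(3)[OF F(1)] that by (simp add: defs)
  have \<sigma>le: "\<sigma> i \<le> fst x" if "i \<le> k" for i
    using delta_functorD(2)[OF F(1)] that by (simp add: defs)
  have \<rho>mono: "\<rho> i \<le> \<rho> j" if "i \<le> j" "j \<le> l" for i j
    using delta_functorD(3)[OF G(2)] that by (simp add: defs)
  have \<rho>le: "\<rho> i \<le> fst z" if "i \<le> l" for i
    using delta_functorD(2)[OF G(2)] that by (simp add: defs)
  define \<alpha> \<beta> where "\<alpha> = delta_of q (\<lambda>i. \<sigma> (u i))" and "\<beta> = delta_of q (\<lambda>i. \<rho> (e i))"
  have A: "is_functor (ord_cat q) (ord_cat (fst x)) \<alpha>"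
    unfolding \<alpha>_def by (intro is_functor_delta_of \<sigma>le \<sigma>mono umono u) auto
  have B: "is_functor (ord_cat q) (ord_cat (fst z)) \<beta>"
    unfolding \<beta>_def by (intro is_functor_delta_of \<rho>le \<rho>mono emono u) auto
  have [simp]: "omap \<alpha> i = \<sigma> (u i)" "omap \<beta> i = \<rho> (e i)" if "i \<le> q" for i
    using that by (simp_all add: \<alpha>_def \<beta>_def delta_of_def)
  have hit: "\<exists>i \<le> q. u i = a \<and> e i = j" if "a \<le> k" "j \<le> l" "\<nu> a = \<tau> j" for a j
  proof -
    have "\<tau> j \<in> \<nu> ` {..k}" using that(1) unfolding that(3)[symmetric] by simp
    then have "j \<in> J" using that unfolding J_def by simp
    then obtain i where i: "i \<le> q" "e i = j" using eJ by auto
    then have "\<nu> (u i) = \<nu> a" using u[of i] that by simp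
    then have "u i = a" using u[of i] i that mf unfolding delta_mono_def inj_on_def by (auto simp: defs)
    then show ?thesis using i by blast
  qed
  have Aim: "omap \<alpha> ` {..q} = {..fst x}"
  proof
    show "omap \<alpha> ` {..q} \<subseteq> {..fst x}" using \<sigma>le u by auto
    show "{..fst x} \<subseteq> omap \<alpha> ` {..q}"
    proof
      fix a assume "a \<in> {..fst x}"
      then obtain b where b: "b \<le> k" "a = \<sigma> b" using \<sigma>i by (metis atMost_iff imageE)
      obtain j where "j \<in> J" "\<tau> j = \<nu> b" using lift[OF b(1)] by auto
      then obtain i where "i \<le> q" "u i = b" using hit[of b j] b unfolding J_def by auto
      then show "a \<in> omap \<alpha> ` {..q}" using b by (intro image_eqI[of _ _ i]) auto
    qed
  qed
  have Binj: "inj_on (omap \<beta>) {..q}"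
  proof (rule inj_onI)
    fix i j assume ij: "i \<in> {..q}" "j \<in> {..q}" "omap \<beta> i = omap \<beta> j"
    then have "\<rho> (e i) = \<rho> (e j)" by simp
    then have "e i = e j"
      using mg u(3)[of i] u(3)[of j] ij unfolding delta_mono_def inj_on_def by (auto simp: defs)
    then show "i = j" using strict_mono_on_imp_inj_on[OF e] ij by (auto simp: inj_on_def)
  qed
  have "amap \<alpha> (i, j) = (\<sigma> (u i), \<sigma> (u j)) \<and> amap \<beta> (i, j) = (\<rho> (e i), \<rho> (e j))"
    if "i \<le> j" "j \<le> q" for i j
    using delta_functorD(4)[OF A that] delta_functorD(4)[OF B that] that by simp
  moreover have "amap (snd x) (\<sigma> (u i), \<sigma> (u j)) = amap (snd z) (\<rho> (e i), \<rho> (e j))"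
    if "i \<le> j" "j \<le> q" for i j
    using Q(2)[of "u i" "u j"] R(2)[of "e i" "e j"] umono[OF that] emono[OF that] u[of i] u[of j] that
    by simp
  moreover have "omap (snd x) (\<sigma> (u i)) = omap (snd z) (\<rho> (e i))" if "i \<le> q" for i
    using Q(1)[of "u i"] R(1)[of "e i"] u[of i] that by simp
  ultimately have P: "pull q \<alpha> x = pull q \<beta> z"
    unfolding pull_def comp_functor_def by (auto simp: compose_def fun_eq_iff restrict_def)
  define h :: "('o, 'a) sd_arrow" where
    "h = \<lparr>sd_dom = x, sd_cod = z, sd_apex = q, sd_epi = \<alpha>, sd_mono = \<beta>\<rparr>"
  have "h \<in> sd_arrs C"
    using f g A B Aim Binj P by (auto simp: h_def sd_arrs_def delta_epi_def delta_mono_def x_def z_def)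
  moreover have "sd_rel h = sd_rel f O sd_rel g"
  proof -
    have 1: "sd_rel h = {(\<sigma> (u i), \<rho> (e i)) | i. i \<le> q}" unfolding sd_rel_def h_def by force
    have 2: "sd_rel f = {(\<sigma> i, \<nu> i) | i. i \<le> k}" "sd_rel g = {(\<tau> i, \<rho> i) | i. i \<le> l}"
      unfolding sd_rel_def defs by auto
    show ?thesis
    proof (intro set_eqI iffI)
      fix p assume "p \<in> sd_rel h"
      then obtain i where i: "i \<le> q" "p = (\<sigma> (u i), \<rho> (e i))" using 1 by auto
      then have "(\<sigma> (u i), \<nu> (u i)) \<in> sd_rel f" "(\<nu> (u i), \<rho> (e i)) \<in> sd_rel g"
        using u[of i] unfolding 2 by auto
      then show "p \<in> sd_rel f O sd_rel g" using i by auto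
    next
      fix p assume "p \<in> sd_rel f O sd_rel g"
      then obtain a j where "a \<le> k" "j \<le> l" "\<nu> a = \<tau> j" "p = (\<sigma> a, \<rho> j)" unfolding 2 by auto
      then show "p \<in> sd_rel h" using hit[of a j] unfolding 1 by auto
    qed
  qed
  ultimately show "\<exists>h. h \<in> sd_arrs C \<and> sd_dom h = sd_dom f \<and> sd_cod h = sd_cod g \<and> sd_rel h = sd_rel f O sd_rel g"
    by (intro exI[of _ h]) (simp add: h_def x_def z_def)
qed

lemma sd_comp_props:
  assumes "f \<in> sd_arrs C" "g \<in> sd_arrs C" "sd_dom g = sd_cod f"
  shows "sd_comp C g f \<in> sd_arrs C" "sd_dom (sd_comp C g f) = sd_dom f"
    "sd_cod (sd_comp C g f) = sd_cod g" "sd_rel (sd_comp C g f) = sd_rel f O sd_rel g"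
  using theI'[OF sd_comp_ex1[OF assms]] unfolding sd_comp_def by auto

lemma sd_rel_bounds:
  assumes "f \<in> sd_arrs C"
  shows "sd_rel f \<subseteq> {..fst (sd_dom f)} \<times> {..fst (sd_cod f)}"
  using assms delta_functorD(2)
  unfolding sd_rel_def sd_arrs_def delta_epi_def delta_mono_def by fastforce

theorem category_Sd: "category (Sd C)"
proof -
  let ?I = "Ident (Sd C)"
  have id: "?I x \<in> sd_arrs C" "sd_dom (?I x) = x" "sd_cod (?I x) = x" "sd_rel (?I x) = Id_on {..fst x}"
    if "x \<in> sd_objs C" for x
  proof -
    have "is_functor (ord_cat (fst x)) (ord_cat (fst x)) (id_functor (ord_cat (fst x)))"
      by (auto simp: is_functor_def id_functor_def)
    then show "?I x \<in> sd_arrs C" "sd_dom (?I x) = x" "sd_cod (?I x) = x" "sd_rel (?I x) = Id_on {..fst x}"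
      using that by (auto simp: Sd_def sd_arrs_def delta_epi_def delta_mono_def id_functor_def
          inj_on_def sd_rel_def Id_on_def)
  qed
  have dc: "sd_dom f \<in> sd_objs C" "sd_cod f \<in> sd_objs C" if "f \<in> sd_arrs C" for f
    using that by (auto simp: sd_arrs_def)
  have [simp]: "Obj (Sd C) = sd_objs C" "Arr (Sd C) = sd_arrs C" "Dom (Sd C) = sd_dom"
    "Cod (Sd C) = sd_cod" "Comp (Sd C) = sd_comp C" by (simp_all add: Sd_def)
  show ?thesis
  proof (unfold_locales, simp_all add: dc id sd_comp_props)
    fix f assume f: "f \<in> sd_arrs C"
    note i = id[OF dc(1)[OF f]] id[OF dc(2)[OF f]]
    have "Id_on {..fst (sd_dom f)} O sd_rel f = sd_rel f" "sd_rel f O Id_on {..fst (sd_cod f)} = sd_rel f"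
      using sd_rel_bounds[OF f] by fastforce+
    then show "sd_comp C f (?I (sd_dom f)) = f" "sd_comp C (?I (sd_cod f)) f = f"
      using f i by (auto intro!: sd_arr_eqI[of _ C] simp: sd_comp_props)
  next
    fix f g h assume "f \<in> sd_arrs C" "g \<in> sd_arrs C" "h \<in> sd_arrs C"
      "sd_dom g = sd_cod f" "sd_dom h = sd_cod g"
    then show "sd_comp C h (sd_comp C g f) = sd_comp C (sd_comp C h g) f"
      by (intro sd_arr_eqI[of _ C]) (simp_all add: sd_comp_props O_assoc)
  qed
qed

end

theory Submission
  imports Defs
begin

text \<open>
An isomorphism \<open>F\<close> of subdivisions sees a simplex only through the poset of its faces, so it
may permute the vertices of each simplex; in particular it may or may not reverse a given edge.
In a groupoid this does no harm. For a simplex \<open>s\<close> there is an arrow \<open>transition s i j\<close> from its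
\<open>i\<close>-th to its \<open>j\<close>-th object for \<^emph>\<open>all\<close> \<open>i\<close> and \<open>j\<close>, inverses being used when \<open>i > j\<close>, and these
arrows compose as in a chaotic groupoid. Let \<open>\<pi>\<^sub>s\<close> be the map that \<open>F\<close> induces on the vertices
of \<open>s\<close>. The induced functor corrects the orientation of each edge: it sends a non-identity arrow
\<open>f\<close> to the transition from \<open>\<pi>(0)\<close> to \<open>\<pi>(1)\<close> in the \<open>1\<close>-simplex \<open>F f\<close>, where \<open>\<pi>\<close> belongs to
the \<open>1\<close>-simplex \<open>f\<close>.

Why this makes sense: a morphism of the subdivision with distinct ends strictly raises the
dimension, and the front face of dimension \<open>n - 1\<close> maps to each \<open>n\<close>-simplex, so \<open>F\<close> preserves
dimensions (lemma \<open>dim_eq\<close>). A morphism that raises the dimension by exactly one is a face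
inclusion (\<open>sd_arr_codim_1\<close>), hence \<open>F\<close> takes vertices of edges, and edges of \<open>2\<close>-simplices, to
such. Every vertex of a \<open>2\<close>-simplex lies on a non-degenerate edge, so \<open>\<pi>\<^sub>s\<close> is defined in
dimension two as well, and it restricts to the vertex maps of the edges (\<open>edge_of_triangle\<close>).

Why it is functorial: for composable non-identities \<open>f\<close> and \<open>g\<close>, let \<open>s\<close> be the \<open>2\<close>-simplex that
they form. The images of \<open>f\<close> and \<open>g\<close> are the transitions of \<open>F s\<close> along
\<open>\<pi>\<^sub>s(0), \<pi>\<^sub>s(1), \<pi>\<^sub>s(2)\<close>, so their composite is the transition from \<open>\<pi>\<^sub>s(0)\<close> to \<open>\<pi>\<^sub>s(2)\<close>. If \<open>gf\<close>
is not an identity, this is its image because \<open>gf\<close> is the third edge of \<open>s\<close>. If \<open>gf\<close> is an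
identity, then \<open>s\<close> has no third edge; as the inverse of \<open>F\<close> carries edges to edges, neither has
\<open>F s\<close>, and the transition is an identity (\<open>transition_opposite_edge\<close>).

The inverse of \<open>F\<close> induces a functor in the other direction in the same way, and the two functors
are inverse to each other because the vertex maps are.
\<close>

section \<open>Groupoids\<close>

definition ginv :: "('o, 'a) cat \<Rightarrow> 'a \<Rightarrow> 'a" where
  "ginv C f = (SOME g. g \<in> Arr C \<and> Dom C g = Cod C f \<and> Cod C g = Dom C f
    \<and> Comp C g f = Ident C (Dom C f) \<and> Comp C f g = Ident C (Cod C f))"

context groupoid
begin

lemma ginv:
  assumes "f \<in> Arr C"
  shows "ginv C f \<in> Arr C" "Dom C (ginv C f) = Cod C f" "Cod C (ginv C f) = Dom C f"
    "Comp C (ginv C f) f = Ident C (Dom C f)" "Comp C f (ginv C f) = Ident C (Cod C f)"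
proof -
  have "\<exists>g. g \<in> Arr C \<and> Dom C g = Cod C f \<and> Cod C g = Dom C f
    \<and> Comp C g f = Ident C (Dom C f) \<and> Comp C f g = Ident C (Cod C f)"
    using inverse_ex[OF assms] by blast
  from someI_ex[OF this, folded ginv_def]
  show "ginv C f \<in> Arr C" "Dom C (ginv C f) = Cod C f" "Cod C (ginv C f) = Dom C f"
    "Comp C (ginv C f) f = Ident C (Dom C f)" "Comp C f (ginv C f) = Ident C (Cod C f)"
    by auto
qed

lemmas cat_simps = Dom_in Cod_in Ident_in Dom_Ident Cod_Ident Comp_in Dom_Comp Cod_Comp
  Comp_Ident_right Comp_Ident_left ginv

lemma ginv_unique:
  assumes "f \<in> Arr C" "g \<in> Arr C" "Dom C g = Cod C f" "Comp C g f = Ident C (Dom C f)"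
  shows "g = ginv C f"
proof -
  have "g = Comp C g (Comp C f (ginv C f))"
    using assms by (metis Comp_Ident_right ginv(5))
  also have "\<dots> = ginv C f"
    using assms by (metis Comp_Ident_left Comp_assoc ginv(1,2,3))
  finally show ?thesis .
qed

lemma ginv_ginv: "f \<in> Arr C \<Longrightarrow> ginv C (ginv C f) = f"
  by (metis ginv ginv_unique)

lemma ginv_Ident: "X \<in> Obj C \<Longrightarrow> ginv C (Ident C X) = Ident C X"
  by (metis Cod_Ident Comp_Ident_left Dom_Ident Ident_in ginv_unique)

lemma Comp_ginv_cancel:
  assumes "f \<in> Arr C" "g \<in> Arr C" "h \<in> Arr C" "Dom C g = Dom C f" "Dom C h = Dom C g"
  shows "Comp C (Comp C h (ginv C g)) (Comp C g (ginv C f)) = Comp C h (ginv C f)"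
proof -
  have "Comp C (Comp C h (ginv C g)) (Comp C g (ginv C f))
      = Comp C (Comp C (Comp C h (ginv C g)) g) (ginv C f)"
    using assms by (intro Comp_assoc) (simp_all add: cat_simps)
  also have "Comp C (Comp C h (ginv C g)) g = Comp C h (Comp C (ginv C g) g)"
    using assms by (intro Comp_assoc[symmetric]) (simp_all add: cat_simps)
  also have "\<dots> = h" using assms by (metis Comp_Ident_right ginv(4))
  finally show ?thesis .
qed

lemma Comp_eq_imp_ginv:
  assumes "f \<in> Arr C" "g \<in> Arr C" "Dom C g = Cod C f"
  shows "Comp C (Comp C g f) (ginv C f) = g"
  using assms by (metis Comp_Ident_right Comp_assoc ginv(1,3,5))

end

section \<open>Simplices of a groupoid\<close>

text \<open>Transitions are written through the \<open>0\<close>-th object of the simplex, so that one formula covers both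
orders of the indices: for \<open>i \<le> j\<close> it is the arrow of the simplex, for \<open>i > j\<close> the
inverse of one.\<close>

definition transition :: "('o, 'a) cat \<Rightarrow> ('o, 'a) simplex \<Rightarrow> nat \<Rightarrow> nat \<Rightarrow> 'a" where
  "transition C s i j = Comp C (amap (snd s) (0, j)) (ginv C (amap (snd s) (0, i)))"

lemma nerveD:
  assumes "s \<in> nerve C"
  shows "omap (snd s) \<in> {..fst s} \<rightarrow>\<^sub>E Obj C"
    and "amap (snd s) \<in> {(i, j). i \<le> j \<and> j \<le> fst s} \<rightarrow>\<^sub>E Arr C"
    and "i \<le> fst s \<Longrightarrow> omap (snd s) i \<in> Obj C"
    and "i \<le> j \<Longrightarrow> j \<le> fst s \<Longrightarrow> amap (snd s) (i, j) \<in> Arr C"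
    and "i \<le> j \<Longrightarrow> j \<le> fst s \<Longrightarrow> Dom C (amap (snd s) (i, j)) = omap (snd s) i"
    and "i \<le> j \<Longrightarrow> j \<le> fst s \<Longrightarrow> Cod C (amap (snd s) (i, j)) = omap (snd s) j"
    and "i \<le> fst s \<Longrightarrow> amap (snd s) (i, i) = Ident C (omap (snd s) i)"
    and "i \<le> j \<Longrightarrow> j \<le> k \<Longrightarrow> k \<le> fst s \<Longrightarrow>
      Comp C (amap (snd s) (j, k)) (amap (snd s) (i, j)) = amap (snd s) (i, k)"
proof -
  have F: "is_functor (ord_cat (fst s)) C (snd s)" using assms by (auto simp: nerve_def)
  show o: "omap (snd s) \<in> {..fst s} \<rightarrow>\<^sub>E Obj C"
    and a: "amap (snd s) \<in> {(i, j). i \<le> j \<and> j \<le> fst s} \<rightarrow>\<^sub>E Arr C"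
    using F by (auto simp: is_functor_def)
  show "i \<le> fst s \<Longrightarrow> omap (snd s) i \<in> Obj C" using o by auto
  show "i \<le> j \<Longrightarrow> j \<le> fst s \<Longrightarrow> amap (snd s) (i, j) \<in> Arr C" using PiE_mem[OF a, of "(i, j)"] by auto
  note F' = F[unfolded is_functor_def ord_cat_simps, THEN conjunct2, THEN conjunct2]
  show "i \<le> j \<Longrightarrow> j \<le> fst s \<Longrightarrow> Dom C (amap (snd s) (i, j)) = omap (snd s) i"
    "i \<le> j \<Longrightarrow> j \<le> fst s \<Longrightarrow> Cod C (amap (snd s) (i, j)) = omap (snd s) j"
    using bspec[OF F'[THEN conjunct1], of "(i, j)"] by simp_all
  show "i \<le> fst s \<Longrightarrow> amap (snd s) (i, i) = Ident C (omap (snd s) i)"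
    using bspec[OF F'[THEN conjunct2, THEN conjunct1], of i] by simp
  show "i \<le> j \<Longrightarrow> j \<le> k \<Longrightarrow> k \<le> fst s \<Longrightarrow>
      Comp C (amap (snd s) (j, k)) (amap (snd s) (i, j)) = amap (snd s) (i, k)"
    using bspec[OF bspec[OF F'[THEN conjunct2, THEN conjunct2], of "(i, j)"], of "(j, k)"] by simp
qed

lemma fst_pull [simp]: "fst (pull k \<mu> s) = k"
  by (simp add: pull_def)

lemma omap_pull: "i \<le> k \<Longrightarrow> omap (snd (pull k \<mu> s)) i = omap (snd s) (omap \<mu> i)"
  by (simp add: pull_def comp_functor_def compose_def)

lemma amap_pull:
  assumes "is_functor (ord_cat k) (ord_cat n) \<mu>" "i \<le> j" "j \<le> k"
  shows "amap (snd (pull k \<mu> s)) (i, j) = amap (snd s) (omap \<mu> i, omap \<mu> j)"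
  using assms delta_functorD(4)[OF assms] by (simp add: pull_def comp_functor_def compose_def)

lemma pull_in_nerve:
  assumes \<mu>: "is_functor (ord_cat k) (ord_cat (fst s)) \<mu>" and s: "s \<in> nerve C"
  shows "pull k \<mu> s \<in> nerve C"
proof -
  note D = delta_functorD(2,3)[OF \<mu>]
  note A = amap_pull[OF \<mu>, of _ _ s]
  have "is_functor (ord_cat k) C (snd (pull k \<mu> s))"
    unfolding is_functor_def
  proof (intro conjI ballI impI)
    show "omap (snd (pull k \<mu> s)) \<in> Obj (ord_cat k) \<rightarrow>\<^sub>E Obj C"
      using D nerveD(3)[OF s] by (auto simp: pull_def comp_functor_def compose_def)
    have "amap (snd (pull k \<mu> s)) \<in> extensional {(i, j). i \<le> j \<and> j \<le> k}"
      by (auto simp: pull_def comp_functor_def)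
    then show "amap (snd (pull k \<mu> s)) \<in> Arr (ord_cat k) \<rightarrow>\<^sub>E Arr C"
      using D nerveD(4)[OF s] A by (auto simp: PiE_def)
  qed (use D nerveD(5-8)[OF s] A in \<open>auto simp: omap_pull\<close>)
  then show ?thesis by (simp add: nerve_def pull_def)
qed

context groupoid
begin

lemma amap_eq_transition:
  assumes "s \<in> nerve C" "i \<le> j" "j \<le> fst s"
  shows "amap (snd s) (i, j) = transition C s i j"
  using Comp_eq_imp_ginv[of "amap (snd s) (0, i)" "amap (snd s) (i, j)"] nerveD(4-8)[OF assms(1)] assms
  unfolding transition_def by simp

lemma transition:
  assumes "s \<in> nerve C" "i \<le> fst s" "j \<le> fst s"
  shows "transition C s i j \<in> Arr C"
    and "Dom C (transition C s i j) = omap (snd s) i"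
    and "Cod C (transition C s i j) = omap (snd s) j"
  using assms nerveD(4-8)[OF assms(1)] unfolding transition_def
  by (simp_all add: cat_simps)

lemma Comp_transition:
  assumes "s \<in> nerve C" "i \<le> fst s" "j \<le> fst s" "k \<le> fst s"
  shows "Comp C (transition C s j k) (transition C s i j) = transition C s i k"
  using assms nerveD(4-8)[OF assms(1)] unfolding transition_def
  by (intro Comp_ginv_cancel) auto

lemma transition_refl:
  assumes "s \<in> nerve C" "i \<le> fst s"
  shows "transition C s i i = Ident C (omap (snd s) i)"
  using amap_eq_transition[of s i i] nerveD(7)[of s] assms by simp

lemma transition_sym:
  assumes "s \<in> nerve C" "i \<le> fst s" "j \<le> fst s"
  shows "transition C s j i = ginv C (transition C s i j)"
  using assms by (intro ginv_unique) (simp_all add: transition Comp_transition transition_refl)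

text \<open>The arrows out of the \<open>0\<close>-th object determine all others, by division.\<close>

lemma simplex_eqI:
  assumes s: "s \<in> nerve C" and t: "t \<in> nerve C" and n: "fst s = fst t"
    and a: "\<And>i. i \<le> fst t \<Longrightarrow> amap (snd s) (0, i) = amap (snd t) (0, i)"
  shows "s = t"
proof -
  have "amap (snd s) = amap (snd t)"
  proof (rule PiE_ext[OF nerveD(2)[OF s] nerveD(2)[OF t, folded n]], clarify)
    fix i j assume "i \<le> j" "j \<le> fst s"
    then show "amap (snd s) (i, j) = amap (snd t) (i, j)"
      using a n by (simp add: amap_eq_transition s t transition_def[of C _ i j])
  qed
  moreover have "omap (snd s) = omap (snd t)"
  proof (rule PiE_ext[OF nerveD(1)[OF s] nerveD(1)[OF t, folded n]])
    fix i assume "i \<in> {..fst s}"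
    then show "omap (snd s) i = omap (snd t) i"
      using a[of i] n nerveD(6)[OF s, of 0 i] nerveD(6)[OF t, of 0 i] by simp
  qed
  ultimately show ?thesis using n by (auto intro!: prod_eqI)
qed

end

text \<open>A simplex of a groupoid amounts to arrows \<open>b 0, \<dots>, b n\<close> out of a common object; functoriality is
then a cancellation, uniform in the dimension. This avoids case distinctions on indices when
edges and triangles are built.\<close>

definition cone :: "('o, 'a) cat \<Rightarrow> nat \<Rightarrow> (nat \<Rightarrow> 'a) \<Rightarrow> ('o, 'a) simplex" where
  "cone C n b = (n, \<lparr>omap = (\<lambda>i \<in> {..n}. Cod C (b i)),
     amap = (\<lambda>(i, j) \<in> {(i, j). i \<le> j \<and> j \<le> n}. Comp C (b j) (ginv C (b i)))\<rparr>)"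

context groupoid
begin

lemma fst_cone [simp]: "fst (cone C n b) = n"
  by (simp add: cone_def)

lemma omap_cone: "i \<le> n \<Longrightarrow> omap (snd (cone C n b)) i = Cod C (b i)"
  by (simp add: cone_def)

lemma amap_cone: "i \<le> j \<Longrightarrow> j \<le> n \<Longrightarrow> amap (snd (cone C n b)) (i, j) = Comp C (b j) (ginv C (b i))"
  by (simp add: cone_def)

lemma cone_in_nerve:
  assumes "\<And>i. i \<le> n \<Longrightarrow> b i \<in> Arr C \<and> Dom C (b i) = X"
  shows "cone C n b \<in> nerve C"
  using assms unfolding nerve_def cone_def is_functor_def
  by (auto simp: cat_simps Comp_ginv_cancel)

lemma amap_cone_0:
  assumes "b 0 = Ident C X" "X \<in> Obj C" "i \<le> n" "b i \<in> Arr C" "Dom C (b i) = X"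
  shows "amap (snd (cone C n b)) (0, i) = b i"
  using assms by (auto simp: amap_cone ginv_Ident Comp_Ident_right)

end

section \<open>Non-degenerate simplices\<close>

lemma delta_mono_self:
  assumes "delta_mono n n \<mu>" shows "\<mu> = id_functor (ord_cat n)"
proof -
  have F: "is_functor (ord_cat n) (ord_cat n) \<mu>" and i: "inj_on (omap \<mu>) {..n}"
    using assms by (auto simp: delta_mono_def)
  have "omap \<mu> ` {..n} = {..n}"
    using i delta_functorD(2)[OF F] by (intro endo_inj_surj) auto
  then have "omap \<mu> i = i" if "i \<le> n" for i
    using strict_enum_unique[OF delta_mono_strict[OF assms], of "\<lambda>i. i" i] that
    by (simp add: strict_mono_on_def)
  then have "delta_of n (omap \<mu>) = id_functor (ord_cat n)"
    unfolding delta_of_def id_functor_def by (auto intro!: restrict_ext)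
  then show ?thesis using delta_functorD(1)[OF F] by simp
qed

lemma delta_epi_le: assumes "delta_epi k n \<mu>" shows "n \<le> k"
proof -
  have "card {..n} \<le> card {..k}" using assms unfolding delta_epi_def by (metis card_image_le finite_atMost)
  then show ?thesis by simp
qed

lemma delta_mono_le: assumes "delta_mono k n \<mu>" shows "k \<le> n"
proof -
  have "omap \<mu> ` {..k} \<subseteq> {..n}" using assms delta_functorD(2) unfolding delta_mono_def by blast
  then have "card {..k} \<le> card {..n}"
    using assms unfolding delta_mono_def by (metis card_inj_on_le finite_atMost)
  then show ?thesis by simp
qed

lemma delta_epi_inj_imp_id:
  assumes e: "delta_epi n m \<mu>" and i: "inj_on (omap \<mu>) {..n}"
  shows "m = n" "\<mu> = id_functor (ord_cat n)"
proof -
  have "delta_mono n m \<mu>" using e i by (simp add: delta_epi_def delta_mono_def)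
  then show "m = n" "\<mu> = id_functor (ord_cat n)"
    using delta_mono_le delta_epi_le[OF e] delta_mono_self by (auto dest: le_antisym)
qed

lemma pull_id:
  assumes "s \<in> nerve C" shows "pull (fst s) (id_functor (ord_cat (fst s))) s = s"
proof -
  have "compose {..fst s} (omap (snd s)) (\<lambda>X \<in> {..fst s}. X) = omap (snd s)"
    using nerveD(1)[OF assms] by (auto simp: compose_def PiE_def extensional_def fun_eq_iff)
  moreover have "compose {(i, j). i \<le> j \<and> j \<le> fst s} (amap (snd s)) (\<lambda>f \<in> {(i, j). i \<le> j \<and> j \<le> fst s}. f)
    = amap (snd s)"
    using nerveD(2)[OF assms] by (auto simp: compose_def PiE_def extensional_def fun_eq_iff)
  ultimately show ?thesis
    by (auto simp: pull_def comp_functor_def id_functor_def intro!: prod_eqI)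
qed

context groupoid
begin

text \<open>If \<open>s\<close> is a proper degeneracy, its epimorphism identifies two neighbouring indices, which makes
the arrow between them an identity. Conversely, if the arrow from \<open>i\<close> to \<open>i + 1\<close> is an
identity, then omitting vertex \<open>i + 1\<close> and repeating vertex \<open>i\<close> gives back \<open>s\<close>.\<close>

lemma degenerate_iff:
  assumes s: "s \<in> nerve C"
  shows "degenerate C s \<longleftrightarrow> (\<exists>i < fst s. amap (snd s) (i, Suc i) = Ident C (omap (snd s) i))"
proof
  assume "degenerate C s"
  then obtain x \<sigma> where x: "x \<in> nerve C" and \<sigma>: "delta_epi (fst s) (fst x) \<sigma>"
    and ne: "\<not> (fst x = fst s \<and> \<sigma> = id_functor (ord_cat (fst s)))" and sx: "s = pull (fst s) \<sigma> x"
    unfolding degenerate_def by blast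
  have F: "is_functor (ord_cat (fst s)) (ord_cat (fst x)) \<sigma>" using \<sigma> by (simp add: delta_epi_def)
  have "\<not> inj_on (omap \<sigma>) {..fst s}" using delta_epi_inj_imp_id[OF \<sigma>] ne by blast
  then obtain i j where ij: "i < j" "j \<le> fst s" "omap \<sigma> i = omap \<sigma> j"
    unfolding inj_on_def by (metis atMost_iff linorder_neqE_nat)
  have "omap \<sigma> (Suc i) = omap \<sigma> i"
    using ij delta_functorD(3)[OF F, of i "Suc i"] delta_functorD(3)[OF F, of "Suc i" j] by simp
  then have "amap (snd s) (i, Suc i) = Ident C (omap (snd s) i)"
    using ij amap_pull[OF F, of i "Suc i" x] omap_pull[of i "fst s" \<sigma> x] sx nerveD(7)[OF x, of "omap \<sigma> i"]
      delta_functorD(2)[OF F, of i] by simp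
  then show "\<exists>i < fst s. amap (snd s) (i, Suc i) = Ident C (omap (snd s) i)"
    using ij by (intro exI[of _ i]) simp
next
  assume "\<exists>i < fst s. amap (snd s) (i, Suc i) = Ident C (omap (snd s) i)"
  then obtain i where i: "i < fst s" "amap (snd s) (i, Suc i) = Ident C (omap (snd s) i)" by blast
  let ?n = "fst s"
  obtain m where m: "?n = Suc m" using i by (cases ?n) auto
  (* d omits the value Suc i; e repeats the value i. *)
  define d e where "d = (\<lambda>j. if j \<le> i then j else Suc j)" and "e = (\<lambda>j. if j \<le> i then j else j - 1)"
  define x where "x = pull m (delta_of m d) s"
  have D: "is_functor (ord_cat m) (ord_cat ?n) (delta_of m d)"
    and E: "is_functor (ord_cat ?n) (ord_cat m) (delta_of ?n e)"
    using i m by (auto intro!: is_functor_delta_of simp: d_def e_def)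
  have [simp]: "omap (delta_of p u) j = u j" if "j \<le> p" for p u j using that by (simp add: delta_of_def)
  have x: "x \<in> nerve C" unfolding x_def by (rule pull_in_nerve[OF D s])
  have eim: "e ` {..?n} = {..m}"
  proof
    show "e ` {..?n} \<subseteq> {..m}" using i m by (auto simp: e_def)
    show "{..m} \<subseteq> e ` {..?n}"
    proof
      fix j assume "j \<in> {..m}"
      then show "j \<in> e ` {..?n}" using m by (intro image_eqI[of _ _ "d j"]) (auto simp: d_def e_def)
    qed
  qed
  then have ep: "delta_epi ?n (fst x) (delta_of ?n e)"
    using E by (simp add: delta_epi_def x_def cong: image_cong_simp)
  have "s = pull ?n (delta_of ?n e) x"
  proof (rule simplex_eqI[OF s])
    show "pull ?n (delta_of ?n e) x \<in> nerve C" using E x by (intro pull_in_nerve) (simp_all add: x_def)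
  next
    fix j assume "j \<le> fst (pull ?n (delta_of ?n e) x)"
    then have j: "j \<le> ?n" by simp
    have ej: "e j \<le> m" using j eim by auto
    have "amap (snd (pull ?n (delta_of ?n e) x)) (0, j) = amap (snd x) (0, e j)"
      using j amap_pull[OF E, of 0 j x] by (simp add: e_def)
    also have "\<dots> = amap (snd s) (0, d (e j))"
      using ej amap_pull[OF D, of 0 "e j" s] by (simp add: x_def d_def)
    also have "\<dots> = amap (snd s) (0, j)"
    proof (cases "j = Suc i")
      case True
      have "amap (snd s) (0, Suc i) = Comp C (amap (snd s) (i, Suc i)) (amap (snd s) (0, i))"
        using i nerveD(8)[OF s, of 0 i "Suc i"] by simp
      also have "\<dots> = amap (snd s) (0, i)"
        using i Comp_Ident_left[of "amap (snd s) (0, i)"] nerveD(4,6)[OF s, of 0 i] by simp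
      finally show ?thesis using True by (simp add: d_def e_def)
    qed (auto simp: d_def e_def)
    finally show "amap (snd s) (0, j) = amap (snd (pull ?n (delta_of ?n e) x)) (0, j)" by simp
  qed simp
  moreover have "fst x \<noteq> ?n" using m by (simp add: x_def)
  ultimately show "degenerate C s" unfolding degenerate_def using x ep by blast
qed


lemma sd_objsI:
  assumes "s \<in> nerve C"
    and "\<And>i. i < fst s \<Longrightarrow> amap (snd s) (i, Suc i) \<noteq> Ident C (omap (snd s) i)"
  shows "s \<in> sd_objs C"
  using assms degenerate_iff unfolding sd_objs_def by blast

lemma sd_objsD:
  assumes "s \<in> sd_objs C"
  shows "s \<in> nerve C"
    and "i < fst s \<Longrightarrow> transition C s i (Suc i) \<noteq> Ident C (omap (snd s) i)"
  using assms degenerate_iff[of s] amap_eq_transition[of s i "Suc i"] unfolding sd_objs_def by auto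

end

definition point :: "('o, 'a) cat \<Rightarrow> 'o \<Rightarrow> ('o, 'a) simplex" where
  "point C X = cone C 0 (\<lambda>_. Ident C X)"

definition edge :: "('o, 'a) cat \<Rightarrow> 'a \<Rightarrow> ('o, 'a) simplex" where
  "edge C f = cone C 1 (\<lambda>i. if i = 0 then Ident C (Dom C f) else f)"

definition triangle :: "('o, 'a) cat \<Rightarrow> 'a \<Rightarrow> 'a \<Rightarrow> ('o, 'a) simplex" where
  "triangle C f g = cone C 2 (\<lambda>i. if i = 0 then Ident C (Dom C f) else if i = 1 then f else Comp C g f)"

context groupoid
begin

lemma point:
  assumes "X \<in> Obj C"
  shows "point C X \<in> sd_objs C" "fst (point C X) = 0" "omap (snd (point C X)) 0 = X"
proof -
  show f: "fst (point C X) = 0" by (simp add: point_def)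
  have "point C X \<in> nerve C" unfolding point_def
    using assms by (intro cone_in_nerve[of _ _ X]) (auto simp: cat_simps)
  then show "point C X \<in> sd_objs C" by (rule sd_objsI) (simp add: f)
  show "omap (snd (point C X)) 0 = X" using assms by (simp add: point_def omap_cone cat_simps)
qed

lemma edge:
  assumes f: "f \<in> Arr C" "f \<noteq> Ident C (Dom C f)"
  shows "edge C f \<in> sd_objs C" "fst (edge C f) = 1" "transition C (edge C f) 0 1 = f"
    "omap (snd (edge C f)) 0 = Dom C f" "omap (snd (edge C f)) 1 = Cod C f"
proof -
  show n: "fst (edge C f) = 1" by (simp add: edge_def)
  have s: "edge C f \<in> nerve C" unfolding edge_def
    using assms by (intro cone_in_nerve[of _ _ "Dom C f"]) (auto simp: cat_simps)
  have "amap (snd (edge C f)) (0, 1) = f"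
    unfolding edge_def using f by (subst amap_cone_0[of _ "Dom C f"]) (auto simp: cat_simps)
  then show t: "transition C (edge C f) 0 1 = f" using amap_eq_transition[OF s, of 0 1] n by simp
  show o: "omap (snd (edge C f)) 0 = Dom C f" "omap (snd (edge C f)) 1 = Cod C f"
    using f by (simp_all add: edge_def omap_cone cat_simps)
  show "edge C f \<in> sd_objs C"
    using s by (rule sd_objsI) (use f t o n amap_eq_transition[OF s, of 0 1] in auto)
qed

lemma triangle:
  assumes f: "f \<in> Arr C" "f \<noteq> Ident C (Dom C f)" and g: "g \<in> Arr C" "g \<noteq> Ident C (Dom C g)"
    and fg: "Dom C g = Cod C f"
  shows "triangle C f g \<in> sd_objs C" "fst (triangle C f g) = 2"
    "transition C (triangle C f g) 0 1 = f" "transition C (triangle C f g) 1 2 = g"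
    "transition C (triangle C f g) 0 2 = Comp C g f"
proof -
  let ?s = "triangle C f g"
  show n: "fst ?s = 2" by (simp add: triangle_def)
  have s: "?s \<in> nerve C" unfolding triangle_def
    using assms by (intro cone_in_nerve[of _ _ "Dom C f"]) (auto simp: cat_simps)
  have "amap (snd ?s) (0, 1) = f" "amap (snd ?s) (0, 2) = Comp C g f"
    unfolding triangle_def using f g fg by (subst amap_cone_0[of _ "Dom C f"]; auto simp: cat_simps)+
  then show t: "transition C ?s 0 1 = f" "transition C ?s 0 2 = Comp C g f"
    using amap_eq_transition[OF s, of 0] n by simp_all
  have "amap (snd ?s) (1, 2) = Comp C (Comp C g f) (ginv C f)"
    by (simp add: triangle_def amap_cone)
  also have "\<dots> = g" using f g fg by (intro Comp_eq_imp_ginv) auto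
  finally show t2: "transition C ?s 1 2 = g" using amap_eq_transition[OF s, of 1 2] n by simp
  have o: "omap (snd ?s) 0 = Dom C f" "omap (snd ?s) 1 = Cod C f"
    using f by (simp_all add: triangle_def omap_cone cat_simps)
  show "?s \<in> sd_objs C"
  proof (rule sd_objsI[OF s])
    fix i assume "i < fst ?s"
    then have "i = 0 \<or> i = 1" using n by auto
    then show "amap (snd ?s) (i, Suc i) \<noteq> Ident C (omap (snd ?s) i)"
      using t t2 o f g fg n amap_eq_transition[OF s, of i "Suc i"] by (auto simp: numeral_2_eq_2)
  qed
qed

lemma eq_point:
  assumes "s \<in> nerve C" "fst s = 0" shows "s = point C (omap (snd s) 0)"
proof -
  have o: "omap (snd s) 0 \<in> Obj C" using nerveD(3)[OF assms(1)] by simp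
  then have p: "point C (omap (snd s) 0) \<in> nerve C" using point sd_objsD by blast
  show ?thesis
    using nerveD(7)[OF assms(1), of 0] nerveD(7)[OF p, of 0] point[OF o] assms(2)
    by (intro simplex_eqI[OF assms(1) p]) auto
qed

lemma eq_edge:
  assumes s: "s \<in> sd_objs C" "fst s = 1" and f: "transition C s 0 1 = f"
  shows "f \<in> Arr C" "f \<noteq> Ident C (Dom C f)" "s = edge C f"
proof -
  note n = sd_objsD(1)[OF s(1)]
  show 1: "f \<in> Arr C" "f \<noteq> Ident C (Dom C f)"
    using transition[OF n, of 0 1] sd_objsD(2)[OF s(1), of 0] s f by auto
  note e = edge[OF 1] and en = sd_objsD(1)[OF edge(1)[OF 1]]
  show "s = edge C f"
  proof (rule simplex_eqI[OF n en])
    fix i assume "i \<le> fst (edge C f)"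
    then have "i = 0 \<or> i = 1" using e by auto
    then show "amap (snd s) (0, i) = amap (snd (edge C f)) (0, i)"
      using e(2-4) s f amap_eq_transition[OF n, of 0 1] amap_eq_transition[OF en, of 0 1]
        nerveD(7)[OF n, of 0] nerveD(7)[OF en, of 0] transition(2)[OF n, of 0 1] by auto
  qed (use s e in simp)
qed

end

section \<open>Arrows of the subdivision as relations\<close>

lemma Sd_simps [simp]:
  "Obj (Sd C) = sd_objs C" "Arr (Sd C) = sd_arrs C" "Dom (Sd C) = sd_dom"
  "Cod (Sd C) = sd_cod" "Comp (Sd C) = sd_comp C"
  by (simp_all add: Sd_def)

lemma sd_arrsD:
  assumes "h \<in> sd_arrs C"
  shows "sd_dom h \<in> sd_objs C" "sd_cod h \<in> sd_objs C"
    and "delta_epi (sd_apex h) (fst (sd_dom h)) (sd_epi h)"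
    and "is_functor (ord_cat (sd_apex h)) (ord_cat (fst (sd_dom h))) (sd_epi h)"
    and "delta_mono (sd_apex h) (fst (sd_cod h)) (sd_mono h)"
    and "is_functor (ord_cat (sd_apex h)) (ord_cat (fst (sd_cod h))) (sd_mono h)"
    and "pull (sd_apex h) (sd_epi h) (sd_dom h) = pull (sd_apex h) (sd_mono h) (sd_cod h)"
  using assms by (auto simp: sd_arrs_def delta_epi_def delta_mono_def)

lemma Domain_sd_rel:
  assumes "h \<in> sd_arrs C" shows "Domain (sd_rel h) = {..fst (sd_dom h)}"
proof -
  have "Domain (sd_rel h) = omap (sd_epi h) ` {..sd_apex h}" unfolding sd_rel_def by auto
  then show ?thesis using sd_arrsD(3)[OF assms] by (simp add: delta_epi_def)
qed

text \<open>An apex as large as the target makes the monomorphism an identity, so the target is a degeneracy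
of the source; being non-degenerate, it is the source.\<close>

lemma sd_arr_same_apex:
  assumes h: "h \<in> sd_arrs C" and a: "sd_apex h = fst (sd_cod h)"
  shows "sd_dom h = sd_cod h"
proof -
  have n: "sd_dom h \<in> nerve C" "sd_cod h \<in> nerve C" "\<not> degenerate C (sd_cod h)"
    using sd_arrsD(1,2)[OF h] by (auto simp: sd_objs_def)
  have "sd_mono h = id_functor (ord_cat (fst (sd_cod h)))"
    using sd_arrsD(5)[OF h] a delta_mono_self by simp
  then have c: "sd_cod h = pull (fst (sd_cod h)) (sd_epi h) (sd_dom h)"
    using sd_arrsD(7)[OF h] a pull_id[OF n(2)] by simp
  then have "fst (sd_dom h) = fst (sd_cod h) \<and> sd_epi h = id_functor (ord_cat (fst (sd_cod h)))"
    using n sd_arrsD(3)[OF h] a unfolding degenerate_def by metis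
  then show ?thesis using c pull_id[OF n(1)] by simp
qed

lemma sd_arr_dim:
  assumes h: "h \<in> sd_arrs C" and ne: "sd_dom h \<noteq> sd_cod h"
  shows "fst (sd_dom h) \<le> sd_apex h" "sd_apex h < fst (sd_cod h)"
  using delta_epi_le[OF sd_arrsD(3)[OF h]] delta_mono_le[OF sd_arrsD(5)[OF h]]
    sd_arr_same_apex[OF h] ne by (auto simp: le_less)

definition face_rel :: "nat \<Rightarrow> (nat \<Rightarrow> nat) \<Rightarrow> (nat \<times> nat) set" where
  "face_rel m \<nu> = {(i, \<nu> i) | i. i \<le> m}"

definition face :: "nat \<Rightarrow> (nat \<Rightarrow> nat) \<Rightarrow> ('o, 'a) simplex \<Rightarrow> ('o, 'a) sd_arrow" where
  "face m \<nu> s = \<lparr>sd_dom = pull m (delta_of m \<nu>) s, sd_cod = s, sd_apex = m,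
     sd_epi = id_functor (ord_cat m), sd_mono = delta_of m \<nu>\<rparr>"

abbreviation vertex :: "('o, 'a) simplex \<Rightarrow> nat \<Rightarrow> ('o, 'a) sd_arrow" where
  "vertex s i \<equiv> face 0 (\<lambda>_. i) s"

lemma face_rel_0: "face_rel 0 \<nu> = {(0, \<nu> 0)}"
  by (auto simp: face_rel_def)

lemma face_rel_1: "face_rel 1 \<nu> = {(0, \<nu> 0), (1, \<nu> 1)}"
  by (auto simp: face_rel_def le_Suc_eq)

text \<open>The apex lies between the dimensions of the ends and is smaller than that of the target, so it
equals the dimension of the source. Then the epimorphism is an identity.\<close>

lemma sd_arr_codim_1:
  assumes h: "h \<in> sd_arrs C" and d: "fst (sd_cod h) = Suc (fst (sd_dom h))"
  obtains \<nu> where "strict_mono_on {..fst (sd_dom h)} \<nu>"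
    "\<And>i. i \<le> fst (sd_dom h) \<Longrightarrow> \<nu> i \<le> fst (sd_cod h)" "sd_rel h = face_rel (fst (sd_dom h)) \<nu>"
proof -
  let ?m = "fst (sd_dom h)"
  have a: "sd_apex h = ?m" using sd_arr_dim[OF h] d by fastforce
  have "inj_on (omap (sd_epi h)) {..?m}"
    using sd_arrsD(3)[OF h] a by (intro eq_card_imp_inj_on) (simp_all add: delta_epi_def)
  then have "sd_epi h = id_functor (ord_cat ?m)"
    using delta_epi_inj_imp_id(2)[OF sd_arrsD(3)[OF h]] a by simp
  then have "sd_rel h = face_rel ?m (omap (sd_mono h))"
    unfolding sd_rel_def face_rel_def a by (auto simp: id_functor_def)
  then show thesis
    using that[of "omap (sd_mono h)"] delta_mono_strict[OF sd_arrsD(5)[OF h]]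
      delta_functorD(2)[OF sd_arrsD(6)[OF h]] a by simp
qed

context groupoid
begin

lemma transition_pull:
  assumes s: "s \<in> nerve C" and \<mu>: "is_functor (ord_cat k) (ord_cat (fst s)) \<mu>" and ij: "i \<le> k" "j \<le> k"
  shows "transition C (pull k \<mu> s) i j = transition C s (omap \<mu> i) (omap \<mu> j)"
proof -
  note p = pull_in_nerve[OF \<mu> s] and D = delta_functorD(2,3)[OF \<mu>]
  have le: "transition C (pull k \<mu> s) i j = transition C s (omap \<mu> i) (omap \<mu> j)" if "i \<le> j" "j \<le> k" for i j
    using amap_pull[OF \<mu> that, of s] amap_eq_transition[OF p, of i j]
      amap_eq_transition[OF s, of "omap \<mu> i" "omap \<mu> j"] D that
    by (metis fst_pull)
  show ?thesis
  proof (cases "i \<le> j")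
    case False
    then show ?thesis
      using le[of j i] ij transition_sym[OF p, of j i] transition_sym[OF s, of "omap \<mu> j" "omap \<mu> i"] D by simp
  qed (use le ij in simp)
qed

text \<open>Since transitions exist between indices in either order, the condition \<open>\<sigma>\<^sup>*x = \<nu>\<^sup>*y\<close> can be
used on arbitrary pairs of related indices.\<close>

lemma sd_rel_transition:
  assumes h: "h \<in> sd_arrs C" and a: "(i, j) \<in> sd_rel h" "(i', j') \<in> sd_rel h"
  shows "transition C (sd_dom h) i i' = transition C (sd_cod h) j j'"
proof -
  obtain u u' where u: "u \<le> sd_apex h" "i = omap (sd_epi h) u" "j = omap (sd_mono h) u"
    and u': "u' \<le> sd_apex h" "i' = omap (sd_epi h) u'" "j' = omap (sd_mono h) u'"
    using a unfolding sd_rel_def by blast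
  note D = sd_arrsD[OF h]
  have "transition C (sd_dom h) i i' = transition C (pull (sd_apex h) (sd_epi h) (sd_dom h)) u u'"
    unfolding u u' using transition_pull[OF sd_objsD(1)[OF D(1)] D(4)] u u' by simp
  also have "\<dots> = transition C (sd_cod h) j j'"
    unfolding u u' D(7) using transition_pull[OF sd_objsD(1)[OF D(2)] D(6)] u u' by simp
  finally show ?thesis .
qed

lemma sd_rel_omap:
  assumes h: "h \<in> sd_arrs C" and a: "(i, j) \<in> sd_rel h"
  shows "omap (snd (sd_dom h)) i = omap (snd (sd_cod h)) j"
proof -
  note D = sd_arrsD[OF h]
  show ?thesis using a pull_eqD(1)[OF D(7) D(4) D(6)] unfolding sd_rel_def by auto
qed

text \<open>The relation determines the transitions of the source from those of the target, hence the source
itself. Arrows with a given target can thus be compared without comparing their sources.\<close>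

lemma sd_arr_eq_by_rel:
  assumes h: "h \<in> sd_arrs C" and h': "h' \<in> sd_arrs C"
    and c: "sd_cod h = sd_cod h'" and r: "sd_rel h = sd_rel h'"
  shows "h = h'"
proof (rule sd_arr_eqI[OF h h' _ c r])
  note n = sd_objsD(1)[OF sd_arrsD(1)[OF h]] and n' = sd_objsD(1)[OF sd_arrsD(1)[OF h']]
  have "{..fst (sd_dom h)} = {..fst (sd_dom h')}"
    using Domain_sd_rel[OF h] Domain_sd_rel[OF h'] r by simp
  then have d: "fst (sd_dom h) = fst (sd_dom h')" by (metis atMost_eq_iff)
  show "sd_dom h = sd_dom h'"
  proof (rule simplex_eqI[OF n n' d])
    fix i assume i: "i \<le> fst (sd_dom h')"
    then have "0 \<in> Domain (sd_rel h)" "i \<in> Domain (sd_rel h)" using Domain_sd_rel[OF h] d by auto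
    then obtain a b where "(0, a) \<in> sd_rel h" "(i, b) \<in> sd_rel h" by auto
    then have "transition C (sd_dom h) 0 i = transition C (sd_dom h') 0 i"
      using sd_rel_transition[OF h] sd_rel_transition[OF h'] c r by metis
    then show "amap (snd (sd_dom h)) (0, i) = amap (snd (sd_dom h')) (0, i)"
      using amap_eq_transition[OF n] amap_eq_transition[OF n'] i d by simp
  qed
qed

lemma face:
  assumes s: "s \<in> sd_objs C" and \<nu>: "strict_mono_on {..m} \<nu>" "\<nu> m \<le> fst s"
    and nd: "\<And>i. i < m \<Longrightarrow> transition C s (\<nu> i) (\<nu> (Suc i)) \<noteq> Ident C (omap (snd s) (\<nu> i))"
  shows "face m \<nu> s \<in> sd_arrs C" "sd_rel (face m \<nu> s) = face_rel m \<nu>"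
    "sd_cod (face m \<nu> s) = s" "fst (sd_dom (face m \<nu> s)) = m"
proof -
  have mono: "\<nu> i \<le> \<nu> j" if "i \<le> j" "j \<le> m" for i j
    using \<nu>(1) that by (metis atMost_iff le_trans order.order_iff_strict strict_mono_onD)
  have F: "is_functor (ord_cat m) (ord_cat (fst s)) (delta_of m \<nu>)"
    using mono \<nu>(2) by (intro is_functor_delta_of) (auto intro: le_trans)
  have o: "omap (delta_of m \<nu>) i = \<nu> i" if "i \<le> m" for i using that by (simp add: delta_of_def)
  have "inj_on (omap (delta_of m \<nu>)) {..m}"
    using strict_mono_on_imp_inj_on[OF \<nu>(1)] o by (simp add: inj_on_def)
  then have M: "delta_mono m (fst s) (delta_of m \<nu>)" using F by (simp add: delta_mono_def)
  let ?x = "pull m (delta_of m \<nu>) s"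
  have sn: "s \<in> nerve C" using s sd_objsD by blast
  have x: "?x \<in> nerve C" using pull_in_nerve[OF F sn] .
  have "?x \<in> sd_objs C"
    using x
  proof (rule sd_objsI)
    fix i assume "i < fst ?x"
    then show "amap (snd ?x) (i, Suc i) \<noteq> Ident C (omap (snd ?x) i)"
      using nd[of i] amap_eq_transition[OF x, of i "Suc i"] transition_pull[OF sn F, of i "Suc i"] o
      by (simp add: omap_pull)
  qed
  moreover have "delta_epi m m (id_functor (ord_cat m))"
    by (auto simp: delta_epi_def is_functor_def id_functor_def)
  moreover have "pull m (id_functor (ord_cat m)) ?x = ?x" using pull_id[OF x] by simp
  ultimately show "face m \<nu> s \<in> sd_arrs C"
    using s M by (simp add: sd_arrs_def face_def)
  show "sd_rel (face m \<nu> s) = face_rel m \<nu>"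
    using o by (force simp: sd_rel_def face_def face_rel_def id_functor_def)
  show "sd_cod (face m \<nu> s) = s" "fst (sd_dom (face m \<nu> s)) = m" by (simp_all add: face_def)
qed

lemma vertex:
  assumes "s \<in> sd_objs C" "i \<le> fst s"
  shows "vertex s i \<in> sd_arrs C" "sd_rel (vertex s i) = {(0, i)}"
    "sd_cod (vertex s i) = s" "fst (sd_dom (vertex s i)) = 0"
proof -
  have "strict_mono_on {..0::nat} (\<lambda>_. i)" by (rule strict_mono_onI) simp
  from face[OF assms(1) this assms(2)]
  show "vertex s i \<in> sd_arrs C" "sd_rel (vertex s i) = {(0, i)}"
    "sd_cod (vertex s i) = s" "fst (sd_dom (vertex s i)) = 0" by (simp_all add: face_rel_0)
qed

lemma vertex_eqI:
  assumes "h \<in> sd_arrs C" "sd_rel h = {(0, i)}" shows "h = vertex (sd_cod h) i"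
proof -
  have "i \<le> fst (sd_cod h)" using sd_rel_bounds[OF assms(1)] assms(2) by auto
  note v = vertex[OF sd_arrsD(2)[OF assms(1)] this]
  show ?thesis using assms v by (intro sd_arr_eq_by_rel) auto
qed

lemma sd_comp_vertex:
  assumes h: "h \<in> sd_arrs C" and r: "sd_rel h = face_rel (fst (sd_dom h)) \<nu>" and u: "u \<le> fst (sd_dom h)"
  shows "sd_comp C h (vertex (sd_dom h) u) = vertex (sd_cod h) (\<nu> u)"
proof -
  note v = vertex[OF sd_arrsD(1)[OF h] u]
  note c = sd_comp_props[OF v(1) h, unfolded v(3), OF refl]
  have "{(0, u)} O face_rel (fst (sd_dom h)) \<nu> = {(0, \<nu> u)}" using u by (auto simp: face_rel_def)
  then show ?thesis using vertex_eqI[OF c(1), of "\<nu> u"] c(3,4) v(2) r by simp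
qed

end


section \<open>Isomorphisms of subdivisions\<close>

text \<open>This is the map \<open>\<pi>\<^sub>s\<close> of the introduction. It is meaningful for simplices of dimension one and
two, where \<open>F\<close> takes vertex inclusions to vertex inclusions.\<close>

definition vertex_map :: "(('o, 'a) simplex, ('o, 'a) sd_arrow, ('p, 'b) simplex, ('p, 'b) sd_arrow) functor_data
    \<Rightarrow> ('o, 'a) simplex \<Rightarrow> nat \<Rightarrow> nat" where
  "vertex_map F s i = (THE j. sd_rel (amap F (vertex s i)) = {(0, j)})"

definition induced_obj where
  "induced_obj G F X = omap (snd (omap F (point G X))) 0"

text \<open>Identities are degenerate \<open>1\<close>-simplices and so have no image under \<open>F\<close>; they need a clause of
their own.\<close>

definition induced_arr where
  "induced_arr G H F f = (if f = Ident G (Dom G f) then Ident H (induced_obj G F (Dom G f))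
    else transition H (omap F (edge G f)) (vertex_map F (edge G f) 0) (vertex_map F (edge G f) 1))"

definition induced_functor where
  "induced_functor G H F =
    \<lparr>omap = restrict (induced_obj G F) (Obj G), amap = restrict (induced_arr G H F) (Arr G)\<rparr>"

locale subdivision_iso = G: groupoid G + H: groupoid H
  for G :: "('o, 'a) cat" and H :: "('p, 'b) cat" +
  fixes F and F'
  assumes F: "is_functor (Sd G) (Sd H) F" and F': "is_functor (Sd H) (Sd G) F'"
    and F'F: "comp_functor (Sd G) F' F = id_functor (Sd G)"
    and FF': "comp_functor (Sd H) F F' = id_functor (Sd H)"
begin

lemma reverse: "subdivision_iso H G F' F"
  by unfold_locales (fact F F' F'F FF')+

lemma omap_F: "s \<in> sd_objs G \<Longrightarrow> omap F s \<in> sd_objs H"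
  using F by (auto simp: is_functor_def)

lemma amap_F:
  assumes "h \<in> sd_arrs G"
  shows "amap F h \<in> sd_arrs H" "sd_dom (amap F h) = omap F (sd_dom h)"
    "sd_cod (amap F h) = omap F (sd_cod h)"
  using F assms by (auto simp: is_functor_def)

lemma amap_F_comp:
  assumes "f \<in> sd_arrs G" "g \<in> sd_arrs G" "sd_dom g = sd_cod f"
  shows "amap F (sd_comp G g f) = sd_comp H (amap F g) (amap F f)"
  using F assms by (simp add: is_functor_def)

lemma omap_F'F:
  assumes "s \<in> sd_objs G" shows "omap F' (omap F s) = s"
proof -
  have "compose (sd_objs G) (omap F') (omap F) = restrict (\<lambda>X. X) (sd_objs G)"
    using F'F by (simp add: comp_functor_def id_functor_def)
  from fun_cong[OF this, of s] show ?thesis using assms by (simp add: compose_def)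
qed

lemma amap_F'F:
  assumes "h \<in> sd_arrs G" shows "amap F' (amap F h) = h"
proof -
  have "compose (sd_arrs G) (amap F') (amap F) = restrict (\<lambda>X. X) (sd_arrs G)"
    using F'F by (simp add: comp_functor_def id_functor_def)
  from fun_cong[OF this, of h] show ?thesis using assms by (simp add: compose_def)
qed

text \<open>The front face \<open>x\<close> of codimension one differs from \<open>s\<close>, hence so do their images, as \<open>F\<close> is
injective on objects. The image of the inclusion of \<open>x\<close> therefore raises the dimension strictly,
and induction applies to \<open>x\<close>.\<close>

lemma dim_le:
  assumes "s \<in> sd_objs G" shows "fst s \<le> fst (omap F s)"
  using assms
proof (induction "fst s" arbitrary: s)
  case (Suc m)
  let ?d = "face m (\<lambda>i. i) s"
  have d: "?d \<in> sd_arrs G" "sd_cod ?d = s" "fst (sd_dom ?d) = m"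
    using G.face[OF Suc.prems, of m "\<lambda>i. i"] G.sd_objsD(2)[OF Suc.prems] Suc.hyps(2)
    by (auto simp: strict_mono_on_def)
  have x: "sd_dom ?d \<in> sd_objs G" using sd_arrsD(1)[OF d(1)] .
  have "sd_dom ?d \<noteq> s" using d(3) Suc.hyps(2) by auto
  then have "omap F (sd_dom ?d) \<noteq> omap F s" using omap_F'F x Suc.prems by metis
  then have "fst (omap F (sd_dom ?d)) < fst (omap F s)"
    using sd_arr_dim[OF amap_F(1)[OF d(1)]] amap_F[OF d(1)] d(2) by simp
  then show ?case using Suc.hyps(1)[of "sd_dom ?d"] x d(3) Suc.hyps(2) by simp
qed simp

lemma dim_eq:
  assumes "s \<in> sd_objs G" shows "fst (omap F s) = fst s"
proof -
  have "fst (omap F s) \<le> fst (omap F' (omap F s))"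
    using subdivision_iso.dim_le[OF reverse] omap_F[OF assms] .
  then show ?thesis using dim_le[OF assms] omap_F'F[OF assms] by simp
qed

lemma vertex_mapI: "sd_rel (amap F (vertex s i)) = {(0, j)} \<Longrightarrow> vertex_map F s i = j"
  unfolding vertex_map_def by auto

lemma amap_F_vertex_of_edge:
  assumes e: "e \<in> sd_objs G" "fst e = 1" and i: "i \<le> 1"
  shows "amap F (vertex e i) = vertex (omap F e) (vertex_map F e i)" "vertex_map F e i \<le> 1"
proof -
  have v: "vertex e i \<in> sd_arrs G" "sd_cod (vertex e i) = e" "fst (sd_dom (vertex e i)) = 0"
    using G.vertex e i by auto
  note a = amap_F[OF v(1)]
  have d: "fst (sd_dom (amap F (vertex e i))) = 0" "fst (sd_cod (amap F (vertex e i))) = 1"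
    using a v e dim_eq[OF sd_arrsD(1)[OF v(1)]] dim_eq[OF e(1)] by auto
  then have "fst (sd_cod (amap F (vertex e i))) = Suc (fst (sd_dom (amap F (vertex e i))))" by simp
  from sd_arr_codim_1[OF a(1) this, unfolded d face_rel_0]
  obtain \<nu> where \<nu>: "\<nu> 0 \<le> 1" "sd_rel (amap F (vertex e i)) = {(0, \<nu> 0)}"
    by (metis le0)
  have m: "vertex_map F e i = \<nu> 0" using vertex_mapI \<nu>(2) .
  show "amap F (vertex e i) = vertex (omap F e) (vertex_map F e i)" "vertex_map F e i \<le> 1"
    using H.vertex_eqI[OF a(1) \<nu>(2)] \<nu>(1) m a(3) v(2) by simp_all
qed

text \<open>Both \<open>d\<close> and its image are edge inclusions, along \<open>\<nu>\<close> and \<open>\<nu>'\<close> say. Composing with the vertices of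
the edge shows \<open>\<pi>\<^sub>s \<circ> \<nu> = \<nu>' \<circ> \<pi>\<^sub>e\<close>, where \<open>e\<close> is the edge and \<open>s\<close> the \<open>2\<close>-simplex. As \<open>\<nu>'\<close>
preserves transitions, the image of the arrow of \<open>e\<close> under the induced functor can be read off
from the image of \<open>s\<close>.\<close>

lemma edge_of_triangle:
  assumes d: "d \<in> sd_arrs G" "fst (sd_dom d) = 1" "fst (sd_cod d) = 2" and r: "sd_rel d = face_rel 1 \<nu>"
  obtains \<nu>' where "\<nu>' 0 < \<nu>' 1" "\<nu>' 1 \<le> 2" "sd_rel (amap F d) = face_rel 1 \<nu>'"
    "\<And>u. u \<le> 1 \<Longrightarrow> vertex_map F (sd_cod d) (\<nu> u) = \<nu>' (vertex_map F (sd_dom d) u)"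
    "\<And>u. u \<le> 1 \<Longrightarrow> amap F (vertex (sd_cod d) (\<nu> u)) = vertex (omap F (sd_cod d)) (vertex_map F (sd_cod d) (\<nu> u))"
    "transition H (omap F (sd_dom d)) (vertex_map F (sd_dom d) 0) (vertex_map F (sd_dom d) 1)
      = transition H (omap F (sd_cod d)) (vertex_map F (sd_cod d) (\<nu> 0)) (vertex_map F (sd_cod d) (\<nu> 1))"
proof -
  let ?e = "sd_dom d" and ?s = "sd_cod d"
  note a = amap_F[OF d(1)]
  note e = sd_arrsD(1)[OF d(1)] and s = sd_arrsD(2)[OF d(1)]
  have fd: "fst (sd_dom (amap F d)) = 1" "fst (sd_cod (amap F d)) = 2"
    using a d e s dim_eq by auto
  obtain \<nu>' where sm: "strict_mono_on {..1} \<nu>'" and le: "\<And>i. i \<le> 1 \<Longrightarrow> \<nu>' i \<le> 2"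
    and r': "sd_rel (amap F d) = face_rel 1 \<nu>'"
    using sd_arr_codim_1[OF a(1), unfolded fd] one_add_one plus_1_eq_Suc by metis
  have v: "amap F (vertex ?s (\<nu> u)) = vertex (omap F ?s) (\<nu>' (vertex_map F ?e u))
      \<and> vertex_map F ?s (\<nu> u) = \<nu>' (vertex_map F ?e u)" if u: "u \<le> 1" for u
  proof -
    note w = amap_F_vertex_of_edge[OF e d(2) u]
    have ve: "vertex ?e u \<in> sd_arrs G" "sd_cod (vertex ?e u) = ?e" using G.vertex[OF e] d(2) u by auto
    have "amap F (vertex ?s (\<nu> u)) = amap F (sd_comp G d (vertex ?e u))"
      using G.sd_comp_vertex[OF d(1), of \<nu> u] r d(2) u by simp
    also have "\<dots> = sd_comp H (amap F d) (vertex (omap F ?e) (vertex_map F ?e u))"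
      using amap_F_comp[OF ve(1) d(1)] ve(2) w(1) by simp
    also have "\<dots> = vertex (omap F ?s) (\<nu>' (vertex_map F ?e u))"
      using H.sd_comp_vertex[OF a(1), of \<nu>'] r' fd a(2,3) w(2) by simp
    finally have *: "amap F (vertex ?s (\<nu> u)) = vertex (omap F ?s) (\<nu>' (vertex_map F ?e u))" .
    have "\<nu>' (vertex_map F ?e u) \<le> fst (omap F ?s)" using le w(2) fd a by simp
    then have "sd_rel (amap F (vertex ?s (\<nu> u))) = {(0, \<nu>' (vertex_map F ?e u))}"
      unfolding * using H.vertex(2)[OF omap_F[OF s]] by blast
    then show ?thesis using * vertex_mapI by blast
  qed
  have t: "transition H (omap F ?e) i j = transition H (omap F ?s) (\<nu>' i) (\<nu>' j)" if "i \<le> 1" "j \<le> 1" for i j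
    using H.sd_rel_transition[OF a(1), of i "\<nu>' i" j "\<nu>' j"] r' that a by (auto simp: face_rel_def)
  show thesis
  proof (rule that[of \<nu>'])
    show "\<nu>' 0 < \<nu>' 1" using strict_mono_onD[OF sm, of 0 1] by simp
    show "\<nu>' 1 \<le> 2" using le by simp
  qed (use v t r' amap_F_vertex_of_edge(2)[OF e d(2)] in auto)
qed

lemma vertex_of_triangle:
  assumes s: "s \<in> sd_objs G" "fst s = 2" and i: "i \<le> 2"
  shows "amap F (vertex s i) = vertex (omap F s) (vertex_map F s i)" "vertex_map F s i \<le> 2"
proof -
  (* The vertex i lies on the edge from k to k + 1, which is never degenerate. *)
  define k where "k = (if i = 2 then 1 else 0 :: nat)"
  have k: "k \<le> 1" "k \<le> i" "i - k \<le> 1" using i by (auto simp: k_def)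
  define d where "d = face 1 (\<lambda>u. u + k) s"
  have d: "d \<in> sd_arrs G" "fst (sd_dom d) = 1" "sd_rel d = face_rel 1 (\<lambda>u. u + k)" "sd_cod d = s"
    unfolding d_def using G.face[OF s(1), of 1 "\<lambda>u. u + k"] s k G.sd_objsD(2)[OF s(1), of k]
    by (auto simp: strict_mono_on_def)
  obtain \<nu>' :: "nat \<Rightarrow> nat" where n: "\<nu>' 0 < \<nu>' 1" "\<nu>' 1 \<le> 2"
    and v: "\<And>u. u \<le> 1 \<Longrightarrow> vertex_map F s (u + k) = \<nu>' (vertex_map F (sd_dom d) u)"
    "\<And>u. u \<le> 1 \<Longrightarrow> amap F (vertex s (u + k)) = vertex (omap F s) (vertex_map F s (u + k))"
    using edge_of_triangle[OF d(1,2) _ d(3)] d(4) s(2) by metis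
  show "amap F (vertex s i) = vertex (omap F s) (vertex_map F s i)" using v(2)[of "i - k"] k by simp
  have "vertex_map F (sd_dom d) (i - k) \<le> 1"
    using amap_F_vertex_of_edge(2)[OF sd_arrsD(1)[OF d(1)] d(2) k(3)] .
  then have "\<nu>' (vertex_map F (sd_dom d) (i - k)) \<le> 2" using n by (cases "vertex_map F (sd_dom d) (i - k)") auto
  then show "vertex_map F s i \<le> 2" using v(1)[of "i - k"] k by simp
qed

lemma vertex_map_inj:
  assumes s: "s \<in> sd_objs G" and v: "\<And>i. i \<le> fst s \<Longrightarrow> amap F (vertex s i) = vertex (omap F s) (vertex_map F s i)"
    and ij: "i \<le> fst s" "j \<le> fst s" "vertex_map F s i = vertex_map F s j"
  shows "i = j"
proof -
  have "amap F (vertex s i) = amap F (vertex s j)" using v ij by simp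
  then have "vertex s i = vertex s j" using amap_F'F G.vertex(1)[OF s] ij by metis
  then have "{(0 :: nat, i)} = {(0, j)}"
    using G.vertex(2)[OF s ij(1)] G.vertex(2)[OF s ij(2)] by metis
  then show ?thesis by simp
qed

lemma induced_arr_transition:
  assumes s: "s \<in> sd_objs G" "fst s = 2" and ij: "i < j" "j \<le> 2"
    and nd: "transition G s i j \<noteq> Ident G (omap (snd s) i)"
  shows "induced_arr G H F (transition G s i j) = transition H (omap F s) (vertex_map F s i) (vertex_map F s j)"
proof -
  define \<nu> where "\<nu> u = (if u = 0 then i else j)" for u :: nat
  define d where "d = face 1 \<nu> s"
  have d: "d \<in> sd_arrs G" "fst (sd_dom d) = 1" "sd_rel d = face_rel 1 \<nu>" "sd_cod d = s"
    unfolding d_def using G.face[OF s(1), of 1 \<nu>] s ij nd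
    by (auto simp: strict_mono_on_def \<nu>_def)
  have "(0, i) \<in> sd_rel d" "(1, j) \<in> sd_rel d" unfolding d(3) face_rel_1 by (simp_all add: \<nu>_def)
  then have "transition G (sd_dom d) 0 1 = transition G s i j"
    using G.sd_rel_transition[OF d(1)] d(4) by blast
  note e = G.eq_edge[OF sd_arrsD(1)[OF d(1)] d(2) this]
  have "fst (sd_cod d) = 2" using d(4) s(2) by simp
  then have "transition H (omap F (sd_dom d)) (vertex_map F (sd_dom d) 0) (vertex_map F (sd_dom d) 1)
      = transition H (omap F s) (vertex_map F s (\<nu> 0)) (vertex_map F s (\<nu> 1))"
    using edge_of_triangle[OF d(1,2) _ d(3)] unfolding d(4) by blast
  then show ?thesis using e unfolding induced_arr_def by (simp add: \<nu>_def)
qed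

lemma induced_obj_in:
  assumes "X \<in> Obj G" shows "induced_obj G F X \<in> Obj H"
  using nerveD(3)[OF H.sd_objsD(1)[OF omap_F[OF G.point(1)[OF assms]]], of 0]
  unfolding induced_obj_def by simp

text \<open>A vertex of an edge is an arrow from a point, so its image shows which object sits at the
corresponding vertex of the image of the edge. This is what makes the induced map on arrows
compatible with domains and codomains.\<close>

lemma omap_F_edge:
  assumes f: "f \<in> Arr G" "f \<noteq> Ident G (Dom G f)" and i: "i \<le> 1"
  shows "omap (snd (omap F (edge G f))) (vertex_map F (edge G f) i)
    = induced_obj G F (if i = 0 then Dom G f else Cod G f)"
proof -
  note e = G.edge[OF f]
  let ?v = "vertex (edge G f) i"
  have v: "?v \<in> sd_arrs G" "sd_rel ?v = {(0, i)}" "sd_cod ?v = edge G f" "fst (sd_dom ?v) = 0"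
    using G.vertex[OF e(1), of i] e(2) i by auto
  note w = amap_F_vertex_of_edge[OF e(1,2) i] and a = amap_F[OF v(1)]
  have "omap (snd (sd_dom ?v)) 0 = omap (snd (edge G f)) i"
    using G.sd_rel_omap[OF v(1), of 0 i] v by simp
  also have "\<dots> = (if i = 0 then Dom G f else Cod G f)" using e(4,5) i by (cases i) auto
  finally have p: "sd_dom ?v = point G (if i = 0 then Dom G f else Cod G f)"
    using G.eq_point[OF G.sd_objsD(1)[OF sd_arrsD(1)[OF v(1)]] v(4)] by simp
  have "sd_rel (amap F ?v) = {(0, vertex_map F (edge G f) i)}"
    using H.vertex(2)[OF omap_F[OF e(1)]] dim_eq[OF e(1)] e(2) w by simp
  then have "omap (snd (sd_dom (amap F ?v))) 0 = omap (snd (sd_cod (amap F ?v))) (vertex_map F (edge G f) i)"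
    using H.sd_rel_omap[OF a(1)] by simp
  then show ?thesis using a(2,3) v(3) p unfolding induced_obj_def by simp
qed

lemma induced_arr_in:
  assumes f: "f \<in> Arr G"
  shows "induced_arr G H F f \<in> Arr H" "Dom H (induced_arr G H F f) = induced_obj G F (Dom G f)"
    "Cod H (induced_arr G H F f) = induced_obj G F (Cod G f)"
proof -
  have "induced_arr G H F f \<in> Arr H \<and> Dom H (induced_arr G H F f) = induced_obj G F (Dom G f)
    \<and> Cod H (induced_arr G H F f) = induced_obj G F (Cod G f)"
  proof (cases "f = Ident G (Dom G f)")
    case True
    then have "Cod G f = Dom G f" using G.Cod_Ident[OF G.Dom_in[OF f]] by simp
    moreover have "induced_arr G H F f = Ident H (induced_obj G F (Dom G f))"
      unfolding induced_arr_def using True by (rule if_P)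
    ultimately show ?thesis
      using H.Ident_in H.Dom_Ident H.Cod_Ident induced_obj_in[OF G.Dom_in[OF f]] by metis
  next
    case False
    note e = G.edge[OF f False]
    note n = H.sd_objsD(1)[OF omap_F[OF e(1)]]
    have "vertex_map F (edge G f) i \<le> fst (omap F (edge G f))" if "i \<le> 1" for i
      using amap_F_vertex_of_edge(2)[OF e(1,2) that] dim_eq[OF e(1)] e(2) by simp
    then show ?thesis
      using H.transition[OF n] omap_F_edge[OF f False] False by (simp add: induced_arr_def)
  qed
  then show "induced_arr G H F f \<in> Arr H" "Dom H (induced_arr G H F f) = induced_obj G F (Dom G f)"
    "Cod H (induced_arr G H F f) = induced_obj G F (Cod G f)" by auto
qed

lemma induced_arr_Ident: "X \<in> Obj G \<Longrightarrow> induced_arr G H F (Ident G X) = Ident H (induced_obj G F X)"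
  by (simp add: induced_arr_def G.cat_simps)

text \<open>Otherwise the two indices span an edge of the image of \<open>s\<close>. Its preimage is an edge of \<open>s\<close>, and by
injectivity of the vertex map this edge joins the vertices \<open>0\<close> and \<open>2\<close>. But the arrow between
these is an identity, so there is no such edge.\<close>

lemma transition_opposite_edge:
  assumes s: "s \<in> sd_objs G" "fst s = 2" and t: "transition G s 0 2 = Ident G (omap (snd s) 0)"
  shows "transition H (omap F s) (vertex_map F s 0) (vertex_map F s 2)
    = Ident H (omap (snd (omap F s)) (vertex_map F s 0))"
proof (rule ccontr)
  let ?t = "omap F s" and ?a = "vertex_map F s 0" and ?b = "vertex_map F s 2"
  assume ne: "transition H ?t ?a ?b \<noteq> Ident H (omap (snd ?t) ?a)"
  have t: "?t \<in> sd_objs H" "fst ?t = 2" "?t \<in> nerve H"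
    using omap_F[OF s(1)] dim_eq[OF s(1)] s(2) H.sd_objsD by auto
  have ab: "?a \<le> 2" "?b \<le> 2" using vertex_of_triangle(2)[OF s] by auto
  have inj: "i = j" if "vertex_map F s i = vertex_map F s j" "i \<le> 2" "j \<le> 2" for i j
    using vertex_map_inj[OF s(1), of i j] vertex_of_triangle(1)[OF s] s(2) that by simp
  have "?a \<noteq> ?b" using inj[of 0 2] by auto
  (* An edge inclusion must be increasing, and the vertex map may reverse the order. *)
  define \<mu> where "\<mu> u = (if u = 0 then min ?a ?b else max ?a ?b)" for u :: nat
  have \<mu>: "\<mu> 0 < \<mu> 1" "\<mu> 1 \<le> 2" "\<mu> u \<in> {?a, ?b}" for u
    using \<open>?a \<noteq> ?b\<close> ab by (auto simp: \<mu>_def min_def max_def)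
  have "transition H ?t (\<mu> 0) (\<mu> 1) \<noteq> Ident H (omap (snd ?t) (\<mu> 0))"
  proof (cases "?a \<le> ?b")
    case False
    have "transition H ?t ?b ?a \<noteq> Ident H (omap (snd ?t) ?b)"
    proof
      assume *: "transition H ?t ?b ?a = Ident H (omap (snd ?t) ?b)"
      have "omap (snd ?t) ?b \<in> Obj H" using nerveD(3)[OF t(3)] ab t by simp
      then have "omap (snd ?t) ?b = omap (snd ?t) ?a"
        using * H.transition(3)[OF t(3), of ?b ?a] ab t H.Cod_Ident by simp
      then show False
        using ne * H.transition_sym[OF t(3), of ?b ?a] H.ginv_Ident[OF \<open>omap (snd ?t) ?b \<in> Obj H\<close>] ab t by simp
    qed
    then show ?thesis using False by (simp add: \<mu>_def)
  qed (use ne in \<open>simp add: \<mu>_def\<close>)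
  then have e': "face 1 \<mu> ?t \<in> sd_arrs H" "sd_rel (face 1 \<mu> ?t) = face_rel 1 \<mu>"
    "sd_cod (face 1 \<mu> ?t) = ?t" "fst (sd_dom (face 1 \<mu> ?t)) = 1"
    using H.face[OF t(1), of 1 \<mu>] \<mu> t by (auto simp: strict_mono_on_def less_Suc_eq le_Suc_eq)
  interpret R: subdivision_iso H G F' F by (rule reverse)
  define d where "d = amap F' (face 1 \<mu> ?t)"
  have d: "d \<in> sd_arrs G" "sd_cod d = s" "fst (sd_dom d) = 1" "amap F d = face 1 \<mu> ?t"
    unfolding d_def using R.amap_F[OF e'(1)] e' omap_F'F[OF s(1)] R.dim_eq[OF sd_arrsD(1)[OF e'(1)]]
      R.amap_F'F[OF e'(1)] by simp_all
  obtain \<nu> where \<nu>: "strict_mono_on {..1} \<nu>" "\<And>i. i \<le> 1 \<Longrightarrow> \<nu> i \<le> 2" "sd_rel d = face_rel 1 \<nu>"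
    using sd_arr_codim_1[OF d(1), unfolded d(2,3) s(2)] one_add_one plus_1_eq_Suc by metis
  have "fst (sd_cod d) = 2" using d s by simp
  then obtain \<nu>' where \<nu>': "sd_rel (amap F d) = face_rel 1 \<nu>'"
    "\<And>u. u \<le> 1 \<Longrightarrow> vertex_map F (sd_cod d) (\<nu> u) = \<nu>' (vertex_map F (sd_dom d) u)"
    using edge_of_triangle[OF d(1,3) _ \<nu>(3)] by metis
  have eq: "\<nu>' u = \<mu> u" if "u \<le> 1" for u
    using \<nu>'(1) e'(2) that unfolding d(4) face_rel_def by auto
  have \<nu>02: "\<nu> u \<in> {0, 2}" if u: "u \<le> 1" for u
  proof -
    have "vertex_map F s (\<nu> u) = \<mu> (vertex_map F (sd_dom d) u)"
      using \<nu>'(2)[OF u] eq amap_F_vertex_of_edge(2)[OF sd_arrsD(1)[OF d(1)] d(3) u] d(2) by simp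
    then have "vertex_map F s (\<nu> u) \<in> {?a, ?b}" using \<mu>(3) by simp
    then show ?thesis using inj \<nu>(2)[OF u] by auto
  qed
  have "\<nu> 0 < \<nu> 1" using strict_mono_onD[OF \<nu>(1), of 0 1] by simp
  then have "\<nu> 0 = 0" "\<nu> 1 = 2" using \<nu>02[of 0] \<nu>02[of 1] by auto
  then have r: "(0, 0) \<in> sd_rel d" "(1, 2) \<in> sd_rel d" unfolding \<nu>(3) face_rel_1 by simp_all
  have "transition G (sd_dom d) 0 1 = Ident G (omap (snd (sd_dom d)) 0)"
    using G.sd_rel_transition[OF d(1) r] G.sd_rel_omap[OF d(1) r(1)] d(2) assms(3) by simp
  then show False using G.sd_objsD(2)[OF sd_arrsD(1)[OF d(1)], of 0] d(3) by simp
qed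

lemma induced_arr_Comp:
  assumes f: "f \<in> Arr G" and g: "g \<in> Arr G" and fg: "Dom G g = Cod G f"
  shows "induced_arr G H F (Comp G g f) = Comp H (induced_arr G H F g) (induced_arr G H F f)"
proof -
  note If = induced_arr_in[OF f] and Ig = induced_arr_in[OF g]
  consider "f = Ident G (Dom G f)" | "g = Ident G (Dom G g)"
    | "f \<noteq> Ident G (Dom G f)" "g \<noteq> Ident G (Dom G g)" by argo
  then show ?thesis
  proof cases
    case 1
    then have "Cod G f = Dom G f" using G.Cod_Ident[OF G.Dom_in[OF f]] by simp
    then have "Comp G g f = g" using 1 fg G.Comp_Ident_right[OF g] by simp
    moreover have "induced_arr G H F f = Ident H (Dom H (induced_arr G H F g))"
      using 1 Ig fg \<open>Cod G f = Dom G f\<close> by (simp add: induced_arr_def)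
    ultimately show ?thesis using H.Comp_Ident_right[OF Ig(1)] by simp
  next
    case 2
    then have "Comp G g f = f" using fg G.Comp_Ident_left[OF f] by simp
    moreover have "induced_arr G H F g = Ident H (Cod H (induced_arr G H F f))"
      using 2 If fg by (simp add: induced_arr_def)
    ultimately show ?thesis using H.Comp_Ident_left[OF If(1)] by simp
  next
    case 3
    let ?s = "triangle G f g" and ?t = "omap F (triangle G f g)"
    let ?\<pi> = "vertex_map F ?s"
    note s = G.triangle[OF f 3(1) g 3(2) fg]
    have sn: "?s \<in> nerve G" and tn: "?t \<in> nerve H" using s(1) omap_F G.sd_objsD H.sd_objsD by blast+
    have tf: "fst ?t = 2" using dim_eq[OF s(1)] s(2) by simp
    have le: "?\<pi> i \<le> 2" if "i \<le> 2" for i using vertex_of_triangle(2)[OF s(1,2) that] .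
    have o: "omap (snd ?s) 0 = Dom G f" "omap (snd ?s) 1 = Dom G g"
      using G.transition(2)[OF sn, of 0 1] G.transition(2)[OF sn, of 1 2] s by auto
    have F1: "induced_arr G H F f = transition H ?t (?\<pi> 0) (?\<pi> 1)"
      using induced_arr_transition[OF s(1,2), of 0 1] s 3 o by simp
    have F2: "induced_arr G H F g = transition H ?t (?\<pi> 1) (?\<pi> 2)"
      using induced_arr_transition[OF s(1,2), of 1 2] s 3 o by simp
    have C: "Comp H (induced_arr G H F g) (induced_arr G H F f) = transition H ?t (?\<pi> 0) (?\<pi> 2)"
      unfolding F1 F2 using H.Comp_transition[OF tn] le tf by simp
    show ?thesis
    proof (cases "Comp G g f = Ident G (Dom G f)")
      case False
      then show ?thesis
        using induced_arr_transition[OF s(1,2), of 0 2] s o C by simp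
    next
      case True
      have "transition H ?t (?\<pi> 0) (?\<pi> 2) = Ident H (omap (snd ?t) (?\<pi> 0))"
        using transition_opposite_edge[OF s(1,2)] s(5) o True by simp
      also have "omap (snd ?t) (?\<pi> 0) = induced_obj G F (Dom G f)"
        using H.transition(2)[OF tn, of "?\<pi> 0" "?\<pi> 1"] le tf If(2) F1 by simp
      finally show ?thesis using C True induced_arr_Ident[OF G.Dom_in[OF f]] by simp
    qed
  qed
qed

lemma induced_functor: "is_functor G H (induced_functor G H F)"
  unfolding is_functor_def induced_functor_def
  using induced_obj_in induced_arr_in induced_arr_Ident induced_arr_Comp
  by (simp add: G.cat_simps)

lemma induced_arr_ginv:
  assumes f: "f \<in> Arr G"
  shows "induced_arr G H F (ginv G f) = ginv H (induced_arr G H F f)"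
proof (rule H.ginv_unique)
  have "Comp H (induced_arr G H F (ginv G f)) (induced_arr G H F f) = induced_arr G H F (Comp G (ginv G f) f)"
    using induced_arr_Comp[OF f G.ginv(1)[OF f] G.ginv(2)[OF f]] G.ginv(4)[OF f] by simp
  then show "Comp H (induced_arr G H F (ginv G f)) (induced_arr G H F f) = Ident H (Dom H (induced_arr G H F f))"
    using f by (simp add: G.ginv induced_arr_Ident induced_arr_in G.Dom_in)
qed (use f in \<open>simp_all add: induced_arr_in G.ginv\<close>)

lemma induced_obj_inverse:
  assumes X: "X \<in> Obj G" shows "induced_obj H F' (induced_obj G F X) = X"
proof -
  note p = G.point[OF X]
  have "omap F (point G X) = point H (induced_obj G F X)"
    using H.eq_point[OF H.sd_objsD(1)[OF omap_F[OF p(1)]]] dim_eq[OF p(1)] p(2)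
    unfolding induced_obj_def by simp
  then show ?thesis using omap_F'F[OF p(1)] p(3) unfolding induced_obj_def[of H] by simp
qed

text \<open>The vertex map of the inverse isomorphism inverts \<open>\<pi>\<close>. If \<open>F\<close> keeps the orientation of the edge
\<open>f\<close>, the claim is immediate; if \<open>F\<close> reverses it, the image of \<open>f\<close> is the inverse of the arrow of
the image edge, and the claim follows since the induced functor preserves inverses.\<close>

lemma induced_arr_inverse:
  assumes f: "f \<in> Arr G" shows "induced_arr H G F' (induced_arr G H F f) = f"
proof -
  interpret R: subdivision_iso H G F' F by (rule reverse)
  show ?thesis
  proof (cases "f = Ident G (Dom G f)")
    case True
    then have "induced_arr G H F f = Ident H (induced_obj G F (Dom G f))" by (simp add: induced_arr_def)
    then show ?thesis
      using True G.Dom_in[OF f] by (simp add: R.induced_arr_Ident induced_obj_in induced_obj_inverse)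
  next
    case False
    let ?e = "edge G f" and ?t = "omap F (edge G f)" and ?k = "transition H (omap F (edge G f)) 0 1"
    let ?\<pi> = "vertex_map F (edge G f)"
    note e = G.edge[OF f False] and en = G.sd_objsD(1)[OF G.edge(1)[OF f False]]
    have t: "?t \<in> sd_objs H" "fst ?t = 1" "?t \<in> nerve H"
      using omap_F[OF e(1)] dim_eq[OF e(1)] e(2) H.sd_objsD by auto
    note k = H.eq_edge[OF t(1,2) refl]
    note v = amap_F_vertex_of_edge[OF e(1,2)]
    have \<pi>': "vertex_map F' ?t (?\<pi> i) = i" if "i \<le> 1" for i
    proof (rule R.vertex_mapI)
      have "amap F' (vertex ?t (?\<pi> i)) = vertex ?e i"
        using v(1)[OF that] amap_F'F[OF G.vertex(1)[OF e(1)], of i] e(2) that by simp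
      then show "sd_rel (amap F' (vertex ?t (?\<pi> i))) = {(0, i)}"
        using G.vertex(2)[OF e(1), of i] e(2) that by simp
    qed
    have K: "induced_arr H G F' ?k = transition G ?e (vertex_map F' ?t 0) (vertex_map F' ?t 1)"
      using k(2) unfolding induced_arr_def k(3)[symmetric] omap_F'F[OF e(1)] by simp
    have F: "induced_arr G H F f = transition H ?t (?\<pi> 0) (?\<pi> 1)" using False by (simp add: induced_arr_def)
    have "?\<pi> 0 \<noteq> ?\<pi> 1" using \<pi>'[of 0] \<pi>'[of 1] by auto
    moreover have "?\<pi> 0 \<le> 1" "?\<pi> 1 \<le> 1" using v(2) by auto
    ultimately consider "?\<pi> 0 = 0" "?\<pi> 1 = 1" | "?\<pi> 0 = 1" "?\<pi> 1 = 0" by linarith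
    then show ?thesis
    proof cases
      case 1
      then show ?thesis using K F \<pi>'[of 0] \<pi>'[of 1] e(3) by simp
    next
      case 2
      have "induced_arr G H F f = ginv H ?k" using F 2 H.transition_sym[OF t(3), of 0 1] t(2) by simp
      then have "induced_arr H G F' (induced_arr G H F f) = ginv G (induced_arr H G F' ?k)"
        using R.induced_arr_ginv[OF k(1)] by simp
      also have "\<dots> = ginv G (transition G ?e 1 0)" using K \<pi>'[of 0] \<pi>'[of 1] 2 by simp
      also have "\<dots> = f" using G.transition_sym[OF en, of 0 1] e(2,3) G.ginv_ginv[OF f] by simp
      finally show ?thesis .
    qed
  qed
qed

lemma induced_functor_inverse:
  "comp_functor G (induced_functor H G F') (induced_functor G H F) = id_functor G"
  unfolding comp_functor_def id_functor_def induced_functor_def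
  by (auto simp: compose_def fun_eq_iff restrict_def induced_obj_in induced_arr_in
      induced_obj_inverse induced_arr_inverse)

end

theorem theorem7p5p1:
  fixes G :: "('o, 'a) cat" and H :: "('p, 'b) cat"
  assumes "groupoid G" and "groupoid H"
    and "is_cat_iso (Sd G) (Sd H) \<Psi>"
  shows "\<exists>P. is_cat_iso G H P"
proof -
  obtain \<Psi>' where \<Psi>': "is_functor (Sd G) (Sd H) \<Psi>" "is_functor (Sd H) (Sd G) \<Psi>'"
    "comp_functor (Sd G) \<Psi>' \<Psi> = id_functor (Sd G)" "comp_functor (Sd H) \<Psi> \<Psi>' = id_functor (Sd H)"
    using assms(3) unfolding is_cat_iso_def by blast
  interpret G: groupoid G by (rule assms(1))
  interpret H: groupoid H by (rule assms(2))
  interpret subdivision_iso G H \<Psi> \<Psi>' by unfold_locales (fact \<Psi>')+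
  interpret R: subdivision_iso H G \<Psi>' \<Psi> by (rule reverse)
  show ?thesis
    unfolding is_cat_iso_def
    using induced_functor R.induced_functor induced_functor_inverse R.induced_functor_inverse by blast
qed

end
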